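(* Let $T>0$ and let $H,L:[0,T]\to\mathbb{C}^{N\times N}$ be continuous Hermitian-matrix-valued functions with $L(t)\succeq 0$ for all $t$, and set $A(t)=L(t)+\mathrm{i}H(t)$. Let $\eta_{\max}=\int_0^T\alpha_{\max}(t)\,\mathrm{d}t$, where $\alpha_{\max}(t)$ is the largest eigenvalue of $L(t)$. Then for every $\epsilon_1\in(0,1)$ there exist real numbers $k'_1,\dots,k'_J$ and complex coefficients $c_1,\dots,c_J$ such that \[ \Big\|\mathcal{T}\mathrm{e}^{-\int_0^T A(s)\mathrm{d}s}-\sum_{j=1}^J c_jU_j\Big\|\le\epsilon_1,\qquad U_j=\mathcal{T}\mathrm{e}^{-\mathrm{i}\int_0^T(H(s)+k'_jL(s))\mathrm{d}s}, \] where $\|\cdot\|$ is the spectral norm, and moreover $J\in\mathcal{O}\big(\log\frac{1}{\epsilon_1}\,(\log\frac{1}{\epsilon_1}+\eta_{\max})\big)$, $\max_j|k'_j|\in\mathcal{O}(\log\frac{1}{\epsilon_1})$, and $\sum_j|c_j|\in\mathcal{O}(1)$, with the implied constants independent of $N$, $T$, $H$, $L$ and $\epsilon_1$.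
   Context: For a continuous matrix-valued function $B:[0,T]\to\mathbb{C}^{N\times N}$, the time-ordered exponential $\mathcal{T}\mathrm{e}^{-\int_0^T B(s)\,\mathrm{d}s}$ denotes $V(T)$, where $V$ solves $\frac{\mathrm{d}V}{\mathrm{d}t}=-B(t)V(t)$, $V(0)=I$. Each $U_j$ is unitary, being the evolution under the Hermitian Hamiltonian $H(s)+k'_jL(s)$. *)

theory Defs
  imports "HOL-Analysis.Analysis" "Jordan_Normal_Form.Schur_Decomposition"
begin

text \<open>Matrices are Jordan_Normal_Form matrices of type complex mat, so that the
  dimension N is a value and can be quantified inside the statement.\<close>

definition hermitian_mat :: "complex mat \<Rightarrow> bool" where
  "hermitian_mat A \<longleftrightarrow> A \<in> carrier_mat (dim_row A) (dim_row A) \<and> mat_adjoint A = A"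

definition psd_mat :: "complex mat \<Rightarrow> bool" where
  "psd_mat A \<longleftrightarrow> hermitian_mat A \<and>
     (\<forall>v \<in> carrier_vec (dim_row A). 0 \<le> Re ((A *\<^sub>v v) \<bullet>c v))"

text \<open>Largest eigenvalue of a Hermitian matrix (its eigenvalues are real).\<close>
definition max_eigenvalue :: "complex mat \<Rightarrow> real" where
  "max_eigenvalue A = Max {a::real. eigenvalue A (complex_of_real a)}"

definition vec_norm2 :: "complex vec \<Rightarrow> real" where
  "vec_norm2 v = sqrt (\<Sum>i<dim_vec v. (cmod (v $ i))\<^sup>2)"

definition spectral_norm :: "complex mat \<Rightarrow> real" where
  "spectral_norm A = Sup {vec_norm2 (A *\<^sub>v v) | v. v \<in> carrier_vec (dim_col A) \<and> vec_norm2 v \<le> 1}"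

definition texp_solution :: "nat \<Rightarrow> (real \<Rightarrow> complex mat) \<Rightarrow> real \<Rightarrow> (real \<Rightarrow> complex mat) \<Rightarrow> bool" where
  "texp_solution N B T V \<longleftrightarrow>
     (\<forall>t \<in> {0..T}. V t \<in> carrier_mat N N) \<and> V 0 = 1\<^sub>m N \<and>
     (\<forall>t \<in> {0..T}. \<forall>i<N. \<forall>j<N.
        ((\<lambda>s. V s $$ (i,j)) has_vector_derivative (- ((B t * V t) $$ (i,j)))) (at t within {0..T}))"

definition time_ordered_exp :: "nat \<Rightarrow> (real \<Rightarrow> complex mat) \<Rightarrow> real \<Rightarrow> complex mat" where
  "time_ordered_exp N B T = (THE M. \<exists>V. texp_solution N B T V \<and> V T = M)"

definition lincomb_mat :: "nat \<Rightarrow> nat \<Rightarrow> (nat \<Rightarrow> complex) \<Rightarrow> (nat \<Rightarrow> complex mat) \<Rightarrow> complex mat" where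
  "lincomb_mat N J c U = mat N N (\<lambda>(a,b). \<Sum>j<J. c j * U j $$ (a,b))"

definition cont_mat_fun :: "nat \<Rightarrow> real \<Rightarrow> (real \<Rightarrow> complex mat) \<Rightarrow> bool" where
  "cont_mat_fun N T F \<longleftrightarrow> (\<forall>t \<in> {0..T}. F t \<in> carrier_mat N N) \<and>
     (\<forall>i<N. \<forall>j<N. continuous_on {0..T} (\<lambda>t. F t $$ (i,j)))"

end

theory Submission
  imports Defs "HOL-Complex_Analysis.Complex_Analysis"
begin

text \<open>
  Let \<open>W(z)\<close> be the time-ordered exponential of \<open>- (\<i> H + z L)\<close>. It is entire in \<open>z\<close>, the target is
  \<open>W(1)\<close> and the unitary evolutions are the values \<open>W(\<i> k)\<close>; an energy estimate gives
  \<open>\<parallel>W(z)\<parallel> \<le> exp (\<eta> max 0 (- Re z))\<close>. Integrate \<open>W(z)\<close> against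
  \<open>exp ((z\<^sup>2 - 1)/R - 2(z - 1)) \<cdot> 2/(1 - z\<^sup>2) \<cdot> (1 - exp (-2\<pi>/h))/(1 - exp (-2\<pi>z/h))\<close>
  over the boundary of the rectangle \<open>-1/2 \<le> Re z \<le> R\<close>, \<open>\<bar>Im z\<bar> \<le> (n + 1/2) h\<close>. The residue at \<open>1\<close> is
  \<open>- W(1)\<close>, the poles \<open>\<i> j h\<close> of the last factor produce the linear combination, and with
  \<open>h = 1/(\<eta> + R + 1)\<close>, \<open>n h \<approx> R\<close> the contour integral is \<open>O(R exp (- R))\<close>. The Gaussian truncates
  the nodes at height \<open>R = O(ln (1/\<epsilon>))\<close>, while the factor \<open>2/(1 - z\<^sup>2)\<close> keeps the sum of the
  coefficients bounded.
\<close>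

section \<open>Residue quadrature on the imaginary axis\<close>

text \<open>Without the Gaussian the weights merely sample the Cauchy density
  \<open>1/(pi (1 + k^2))\<close>, whose tail bound only permits a cutoff of order 1/\<epsilon>. A
  damping factor must be entire, equal to 1 at z = 1, bounded on the imaginary axis and harmless on
  the closing contour. \<open>exp (z^2/R)\<close> is small at height R but grows along the real
  axis; since \<open>x^2/R <= x\<close> on [0,R], the linear term -2z outweighs this growth, and it
  costs only a factor e^2 on the imaginary axis. Left of that axis W may grow like exp(\<eta> |Re
  z|); there the periodic quotient takes over, being of order exp(-2 pi |Re z|/h) away from the
  axis. Hence 1/h has to dominate \<eta> as well as R, and the roughly 2R/h nodes produce the
  product in the bound for J. The left edge at -1/2 separates the nodes from the pole of 1/(1 - z^2)
  at -1. The quadrature is proved for scalar entire functions only: nodes and weights do not depend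
  on the function, so the matrix error can be paired with itself.\<close>

lemma sum_recip_one_plus_square_le:
  fixes h :: real
  assumes "0 \<le> h"
  shows "(\<Sum>j\<in>{1..n}. h / (1 + (real j * h)\<^sup>2)) \<le> arctan (real n * h)"
proof (induction n)
  case (Suc n)
  \<comment> \<open>On x >= 0 the density 1/(1+x^2) decreases, so its value at the right end of a
    cell times h is at most the increment of \<open>arctan\<close> over the cell; the increments
    telescope.\<close>
  have "h / (1 + (real (Suc n) * h)\<^sup>2) \<le> arctan (real (Suc n) * h) - arctan (real n * h)"
  proof (cases "h = 0")
    case False
    then have lt: "real n * h < real (Suc n) * h" using assms by simp
    obtain z where z: "real n * h < z" "z < real (Suc n) * h"
      "arctan (real (Suc n) * h) - arctan (real n * h) = (real (Suc n) * h - real n * h) * inverse (1 + z\<^sup>2)"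
      using MVT2[OF lt, of arctan "\<lambda>x. inverse (1 + x\<^sup>2)"] DERIV_arctan by metis
    have "0 \<le> z" using z(1) assms by (smt (verit) mult_nonneg_nonneg of_nat_0_le_iff)
    then have "z\<^sup>2 \<le> (real (Suc n) * h)\<^sup>2" using z(2) by (intro power_mono) auto
    then have "h / (1 + (real (Suc n) * h)\<^sup>2) \<le> h / (1 + z\<^sup>2)"
      using assms by (intro divide_left_mono) (auto intro!: mult_pos_pos add_pos_nonneg)
    then show ?thesis unfolding z(3) by (simp add: field_simps)
  qed simp
  then show ?case using Suc by (simp del: of_nat_Suc)
qed simp

lemma contour_integral_rectpath_bound:
  assumes f: "continuous_on (path_image (rectpath a b)) f"
    and "0 \<le> B1" "0 \<le> B2" "0 \<le> B3" and ab: "Re a \<le> Re b" "Im a \<le> Im b"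
    and B1: "\<And>x. x \<in> {Re a..Re b} \<Longrightarrow> cmod (f (Complex x (Im a))) \<le> B1"
      "\<And>x. x \<in> {Re a..Re b} \<Longrightarrow> cmod (f (Complex x (Im b))) \<le> B1"
    and B2: "\<And>y. y \<in> {Im a..Im b} \<Longrightarrow> cmod (f (Complex (Re b) y)) \<le> B2"
    and B3: "\<And>y. y \<in> {Im a..Im b} \<Longrightarrow> cmod (f (Complex (Re a) y)) \<le> B3"
  shows "cmod (contour_integral (rectpath a b) f) \<le> 2 * B1 * (Re b - Re a) + (B2 + B3) * (Im b - Im a)"
proof -
  define a2 a4 where "a2 = Complex (Re b) (Im a)" and "a4 = Complex (Re a) (Im b)"
  have pim: "path_image (rectpath a b) = closed_segment a a2 \<union> closed_segment a2 b \<union>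
                  closed_segment b a4 \<union> closed_segment a4 a"
    by (simp add: rectpath_def Let_def path_image_join a2_def a4_def Un_assoc)
  have ci: "f contour_integrable_on linepath a a2" "f contour_integrable_on linepath a2 b"
     "f contour_integrable_on linepath b a4" "f contour_integrable_on linepath a4 a"
    by (auto intro!: contour_integrable_continuous_linepath continuous_on_subset[OF f] simp: pim)
  have eq: "contour_integral (rectpath a b) f = contour_integral (linepath a a2) f + contour_integral (linepath a2 b) f
      + contour_integral (linepath b a4) f + contour_integral (linepath a4 a) f"
    using ci unfolding rectpath_def Let_def a2_def[symmetric] a4_def[symmetric] by simp
  have hseg: "\<exists>x\<in>{Re a..Re b}. z = Complex x t" if "z \<in> closed_segment (Complex s t) (Complex s' t)"
    "s \<in> {Re a..Re b}" "s' \<in> {Re a..Re b}" for z s s' t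
  proof -
    from that(1) obtain u where "0 \<le> u" "u \<le> 1" "z = (1-u) *\<^sub>R Complex s t + u *\<^sub>R Complex s' t"
      by (auto simp: in_segment)
    moreover have "(1-u) * s + u * s' \<in> {Re a..Re b}"
      using convexD[OF convex_real_interval(5), of s "Re a" "Re b" s' "1-u" u] that calculation by auto
    ultimately show ?thesis by (intro bexI[of _ "(1-u) * s + u * s'"]) (auto simp: complex_eq_iff algebra_simps)
  qed
  have vseg: "\<exists>y\<in>{Im a..Im b}. z = Complex t y" if "z \<in> closed_segment (Complex t s) (Complex t s')"
    "s \<in> {Im a..Im b}" "s' \<in> {Im a..Im b}" for z s s' t
  proof -
    from that(1) obtain u where "0 \<le> u" "u \<le> 1" "z = (1-u) *\<^sub>R Complex t s + u *\<^sub>R Complex t s'"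
      by (auto simp: in_segment)
    moreover have "(1-u) * s + u * s' \<in> {Im a..Im b}"
      using convexD[OF convex_real_interval(5), of s "Im a" "Im b" s' "1-u" u] that calculation by auto
    ultimately show ?thesis by (intro bexI[of _ "(1-u) * s + u * s'"]) (auto simp: complex_eq_iff algebra_simps)
  qed
  have a: "a = Complex (Re a) (Im a)" "b = Complex (Re b) (Im b)" by auto
  have "cmod (contour_integral (linepath a a2) f) \<le> B1 * cmod (a2 - a)"
  proof (rule contour_integral_bound_linepath[OF ci(1) \<open>0 \<le> B1\<close>])
    fix z assume "z \<in> closed_segment a a2"
    then show "cmod (f z) \<le> B1" using hseg[of z "Re a" "Im a" "Re b"] ab B1 by (auto simp: a2_def)
  qed
  moreover have "cmod (contour_integral (linepath a2 b) f) \<le> B2 * cmod (b - a2)"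
  proof (rule contour_integral_bound_linepath[OF ci(2) \<open>0 \<le> B2\<close>])
    fix z assume "z \<in> closed_segment a2 b"
    then show "cmod (f z) \<le> B2" using vseg[of z "Re b" "Im a" "Im b"] ab B2 by (auto simp: a2_def)
  qed
  moreover have "cmod (contour_integral (linepath b a4) f) \<le> B1 * cmod (a4 - b)"
  proof (rule contour_integral_bound_linepath[OF ci(3) \<open>0 \<le> B1\<close>])
    fix z assume "z \<in> closed_segment b a4"
    then show "cmod (f z) \<le> B1" using hseg[of z "Re b" "Im b" "Re a"] ab B1 by (auto simp: a4_def)
  qed
  moreover have "cmod (contour_integral (linepath a4 a) f) \<le> B3 * cmod (a - a4)"
  proof (rule contour_integral_bound_linepath[OF ci(4) \<open>0 \<le> B3\<close>])
    fix z assume "z \<in> closed_segment a4 a"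
    then show "cmod (f z) \<le> B3" using vseg[of z "Re a" "Im b" "Im a"] ab B3 by (auto simp: a4_def)
  qed
  moreover have "cmod (a2 - a) = Re b - Re a" "cmod (b - a2) = Im b - Im a"
    "cmod (a4 - b) = Re b - Re a" "cmod (a - a4) = Im b - Im a"
    using ab by (auto simp: a2_def a4_def cmod_def)
  ultimately have "cmod (contour_integral (rectpath a b) f) \<le> B1 * (Re b - Re a) + B2 * (Im b - Im a)
      + B1 * (Re b - Re a) + B3 * (Im b - Im a)"
    unfolding eq by (smt (verit) norm_triangle_ineq)
  then show ?thesis by (simp add: algebra_simps)
qed

section \<open>Residues at simple zeros and the quadrature identity\<close>

lemma residue_quotient_simple_zero:
  assumes f: "f holomorphic_on s" and g: "g holomorphic_on s" and s: "open s" "z \<in> s"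
    and nz: "\<And>w. w \<in> s - {z} \<Longrightarrow> g w \<noteq> 0"
    and g': "(g has_field_derivative g') (at z)" "g z = 0" "g' \<noteq> 0"
  shows "residue (\<lambda>w. f w / g w) z = f z / g'"
proof (rule residue_simple'[OF s])
  show "(\<lambda>w. f w / g w) holomorphic_on s - {z}"
    using f g nz by (intro holomorphic_on_divide) (auto elim: holomorphic_on_subset)
  have "((\<lambda>w. (g w - g z) / (w - z)) \<longlongrightarrow> g') (at z)"
    using g'(1) by (simp add: has_field_derivative_iff)
  moreover have "(f \<longlongrightarrow> f z) (at z)"
    using holomorphic_on_imp_continuous_on[OF f] s
    by (simp add: continuous_on_eq_continuous_at isCont_def)
  ultimately have "((\<lambda>w. f w / ((g w - g z) / (w - z))) \<longlongrightarrow> f z / g') (at z)"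
    using g'(3) by (intro tendsto_divide)
  then show "((\<lambda>w. f w / g w * (w - z)) \<longlongrightarrow> f z / g') (at z)"
    by (simp add: g'(2))
qed

text \<open>Normalised to 1 at z = 1. At z = iy its modulus is exp(2 - (y^2+1)/R): a Gaussian of
  width sqrt R, never above e^2.\<close>

definition quad_kernel :: "real \<Rightarrow> complex \<Rightarrow> complex" where
  "quad_kernel R z = exp ((z\<^sup>2 - 1) / of_real R - 2 * (z - 1))"

text \<open>The shift by \<open>n\<close> lets the indices \<open>j < 2*n+1\<close> run through the
  symmetric grid from -nh to nh.\<close>

definition quad_node :: "real \<Rightarrow> nat \<Rightarrow> nat \<Rightarrow> real" where
  "quad_node h n j = (real j - real n) * h"

text \<open>A trapezoidal weight \<open>h\<close> times the Cauchy density, damped by the kernel.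
  The correction \<open>1 - exp (- 2 * pi / h)\<close> stems from normalising the residue at
  1.\<close>

definition quad_weight :: "real \<Rightarrow> real \<Rightarrow> nat \<Rightarrow> nat \<Rightarrow> complex" where
  "quad_weight R h n j = quad_kernel R (\<i> * of_real (quad_node h n j)) *
     of_real ((1 - exp (- 2 * pi / h)) * h / (pi * (1 + (quad_node h n j)\<^sup>2)))"

lemma cmod_quad_kernel:
  "cmod (quad_kernel R z) = exp (((Re z)\<^sup>2 - (Im z)\<^sup>2 - 1) / R - 2 * (Re z - 1))"
  by (simp add: quad_kernel_def power2_eq_square)

lemma exp_periodic_eq_1_iff:
  fixes h :: real
  assumes "0 < h"
  shows "1 - exp (- 2 * of_real pi * z / of_real h) = 0 \<longleftrightarrow> (\<exists>m::int. z = \<i> * of_real (of_int m * h))"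
proof -
  have "1 - exp (- 2 * of_real pi * z / of_real h) = 0 \<longleftrightarrow> exp (- 2 * of_real pi * z / of_real h) = 1" by auto
  also have "\<dots> \<longleftrightarrow> (\<exists>m::int. Re z = 0 \<and> - Im z = of_int m * h)"
  proof -
    have "- (2 * pi * Im z / h) = of_int (2 * m) * pi \<longleftrightarrow> - Im z = of_int m * h" for m
    proof -
      have "- (2 * pi * Im z / h) = of_int (2 * m) * pi \<longleftrightarrow> (2 * pi / h) * (- Im z) = (2 * pi / h) * (of_int m * h)"
        using assms by (simp add: mult_ac)
      also have "\<dots> \<longleftrightarrow> - Im z = of_int m * h"
        using assms by (subst mult_cancel_left) simp
      finally show ?thesis .
    qed
    then show ?thesis using assms by (simp add: exp_eq_1)
  qed
  also have "\<dots> \<longleftrightarrow> (\<exists>m::int. Re z = 0 \<and> Im z = of_int m * h)"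
  proof safe
    fix m :: int assume "- Im z = of_int m * h"
    then show "\<exists>m::int. Re z = 0 \<and> Im z = of_int m * h" if "Re z = 0"
      using that by (intro exI[of _ "-m"]) simp
  next
    fix m :: int assume "Im z = of_int m * h"
    then show "\<exists>m::int. Re z = 0 \<and> - Im z = of_int m * h" if "Re z = 0"
      using that by (intro exI[of _ "-m"]) simp
  qed
  finally show ?thesis by (simp add: complex_eq_iff)
qed

lemma quadrature_contour_integral:
  fixes \<phi> :: "complex \<Rightarrow> complex" and h R :: real and n :: nat
  assumes \<phi>: "\<phi> holomorphic_on UNIV" and h: "0 < h" and R: "2 \<le> R"
  defines "K \<equiv> (real n + 1/2) * h"
  defines "D \<equiv> (\<lambda>z. (1 - z\<^sup>2) * (1 - exp (- 2 * of_real pi * z / of_real h)))"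
  defines "F \<equiv> (\<lambda>z. \<phi> z * quad_kernel R z * of_real (2 * (1 - exp (- 2 * pi / h))) / D z)"
  shows "continuous_on (path_image (rectpath (Complex (-1/2) (-K)) (Complex R K))) F"
    and "contour_integral (rectpath (Complex (-1/2) (-K)) (Complex R K)) F =
      2 * pi * \<i> * ((\<Sum>j<2*n+1. quad_weight R h n j * \<phi> (\<i> * of_real (quad_node h n j))) - \<phi> 1)"
proof -
  define g where "g = rectpath (Complex (-1/2) (-K)) (Complex R K)"
  \<comment> \<open>An open convex neighbourhood of the rectangle that leaves out -1 and the next
    zeros, at height (n+1)h and -(n+1)h, of the periodic factor. The zeros of \<open>D\<close>
    inside it are therefore exactly \<open>pts\<close>.\<close>
  define S where "S = {z. -1 < Re z} \<inter> {z. Im z < (real n + 1) * h} \<inter> {z. - (real n + 1) * h < Im z}"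
  define p where "p = (\<lambda>j. \<i> * of_real (quad_node h n j))"
  define pts where "pts = insert 1 (p ` {..<2*n+1})"
  define G where "G = (\<lambda>z. \<phi> z * quad_kernel R z * of_real (2 * (1 - exp (- 2 * pi / h))))"
  have F: "F = (\<lambda>z. G z / D z)" by (simp add: F_def G_def)
  have K: "0 < K" using h by (simp add: K_def)
  have KL: "K < (real n + 1) * h" using h by (simp add: K_def)
  have S: "open S" "convex S"
    unfolding S_def by (intro open_Int convex_Int open_halfspace_Re_gt open_halfspace_Im_gt open_halfspace_Im_lt
       convex_halfspace_Re_gt convex_halfspace_Im_gt convex_halfspace_Im_lt)+
  have Gh: "G holomorphic_on A" for A
    unfolding G_def quad_kernel_def using R
    by (intro holomorphic_intros holomorphic_on_subset[OF \<phi>]) auto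
  have Dh: "D holomorphic_on A" for A
    unfolding D_def using h by (intro holomorphic_intros) auto
  have inj: "inj_on p {..<2*n+1}" using h by (auto simp: inj_on_def p_def quad_node_def)
  have Dz: "D z = 0 \<longleftrightarrow> z \<in> pts" if "z \<in> S" for z
  proof
    assume "D z = 0"
    then consider "z\<^sup>2 = 1" | "1 - exp (- 2 * of_real pi * z / of_real h) = 0" by (auto simp: D_def)
    then show "z \<in> pts"
    proof cases
      case 1
      then have "z = 1 \<or> z = -1" by (simp add: power2_eq_1_iff)
      then show ?thesis using that by (auto simp: S_def pts_def)
    next
      case 2
      then obtain m :: int where m: "z = \<i> * of_real (of_int m * h)"
        unfolding exp_periodic_eq_1_iff[OF h] by blast
      have "of_int m * h < (real n + 1) * h" "- (real n + 1) * h < of_int m * h"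
        using that by (auto simp: S_def m)
      then have "of_int m < real n + 1" "- (real n + 1) < of_int m" 
        using h by (simp_all only: mult_less_cancel_right_pos)
      then have "m < int n + 1" "- (int n + 1) < m" by linarith+
      then have "nat (m + int n) < 2*n+1" "z = p (nat (m + int n))"
        by (auto simp: p_def m quad_node_def)
      then show ?thesis by (auto simp: pts_def)
    qed
  next
    assume "z \<in> pts"
    then consider "z = 1" | j where "z = p j" by (auto simp: pts_def)
    then show "D z = 0"
    proof cases
      case 2
      have "1 - exp (- 2 * of_real pi * z / of_real h) = 0"
        unfolding exp_periodic_eq_1_iff[OF h]
        by (rule exI[of _ "int j - int n"]) (simp add: 2 p_def quad_node_def)
      then show ?thesis by (simp add: D_def)
    qed (simp add: D_def)
  qed
  have ptsS: "pts \<subseteq> S"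
  proof -
    have "\<bar>(real j - real n) * h\<bar> < (real n + 1) * h" if "j < 2*n+1" for j
      using that h by (auto simp: abs_mult)
    moreover have "(- real n - 1) * h < 0" using h by (intro mult_neg_pos) auto
    ultimately show ?thesis using h by (auto simp: pts_def S_def p_def quad_node_def abs_less_iff)
  qed
  have ptsin: "z \<in> box (Complex (-1/2) (-K)) (Complex R K)" if "z \<in> pts" for z
  proof -
    have "\<bar>(real j - real n) * h\<bar> < K" if "j < 2*n+1" for j
      using that h by (auto simp: abs_mult K_def)
    then have "- K < (real j - real n) * h \<and> (real j - real n) * h < K" if "j < 2*n+1" for j
      using that by (simp only: abs_less_iff) (smt (verit))
    then show ?thesis using that R K by (auto simp: pts_def p_def quad_node_def in_box_complex_iff)
  qed
  have cS: "cbox (Complex (-1/2) (-K)) (Complex R K) \<subseteq> S"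
    using KL by (auto simp: S_def in_cbox_complex_iff algebra_simps)
  have pg: "path_image g = cbox (Complex (-1/2) (-K)) (Complex R K) - box (Complex (-1/2) (-K)) (Complex R K)"
    unfolding g_def using R K by (intro path_image_rectpath_cbox_minus_box) auto
  have pgS: "path_image g \<subseteq> S - pts" using ptsin cS unfolding pg by auto
  have Fh: "F holomorphic_on S - pts"
    unfolding F by (intro holomorphic_on_divide Gh Dh) (simp add: Dz)
  show "continuous_on (path_image (rectpath (Complex (-1/2) (-K)) (Complex R K))) F"
    using holomorphic_on_subset[OF Fh pgS] unfolding g_def by (rule holomorphic_on_imp_continuous_on)
  have "contour_integral g F = 2 * pi * \<i> * (\<Sum>q\<in>pts. winding_number g q * residue F q)"
  proof (rule Residue_theorem[OF S(1) convex_connected[OF S(2)] _ Fh _ _ pgS])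
    show "\<forall>z. z \<notin> S \<longrightarrow> winding_number g z = 0"
      using cS R K unfolding g_def by (auto intro!: winding_number_rectpath_outside)
  qed (auto simp: pts_def g_def)
  also have "(\<Sum>q\<in>pts. winding_number g q * residue F q) = (\<Sum>q\<in>pts. residue F q)"
    using ptsin by (intro sum.cong refl) (simp add: g_def winding_number_rectpath)
  also have "\<dots> = residue F 1 + (\<Sum>j<2*n+1. residue F (p j))"
  proof -
    have "1 \<notin> p ` {..<2*n+1}" by (auto simp: p_def complex_eq_iff)
    then show ?thesis unfolding pts_def using sum.reindex[OF inj, of "residue F"]
      by (simp del: sum.lessThan_Suc add: comp_def)
  qed
  also have "residue F 1 = - \<phi> 1"
  proof -
    define Q where "Q = 1 - exp (- 2 * pi / h)"
    have Q: "Q \<noteq> 0" using h by (simp add: Q_def)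
    have e: "1 - exp (- 2 * complex_of_real pi / of_real h) = of_real Q"
      by (simp add: Q_def flip: exp_of_real)
    \<comment> \<open>The constant 2Q in the numerator was put into \<open>F\<close> to cancel this
      derivative -2Q of \<open>D\<close> at 1, leaving exactly \<open>- \<phi> 1\<close>.\<close>
    have "residue F 1 = G 1 / (- 2 * of_real Q)"
      unfolding F
    proof (rule residue_quotient_simple_zero[OF Gh Dh, where s="S - (pts - {1})"])
      show "open (S - (pts - {1}))" using S by (intro open_Diff finite_imp_closed) (auto simp: pts_def)
      show "1 \<in> S - (pts - {1})" using ptsS by (auto simp: pts_def)
      show "(D has_field_derivative - 2 * of_real Q) (at 1)"
        unfolding D_def using h e by (auto intro!: derivative_eq_intros)
    qed (use Q Dz in \<open>auto simp: D_def\<close>)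
    moreover have "G 1 = \<phi> 1 * (2 * of_real Q)" by (simp add: G_def quad_kernel_def Q_def)
    ultimately show ?thesis using Q by simp
  qed
  also have "(\<Sum>j<2*n+1. residue F (p j)) = (\<Sum>j<2*n+1. quad_weight R h n j * \<phi> (p j))"
  proof (intro sum.cong refl)
    fix j assume that: "j \<in> {..<2*n+1}"
    define y where "y = quad_node h n j"
    have y: "p j = \<i> * of_real y" by (simp add: p_def y_def)
    have e: "exp (- 2 * of_real pi * p j / of_real h) = 1"
    proof -
      have "1 - exp (- 2 * of_real pi * p j / of_real h) = 0"
        unfolding exp_periodic_eq_1_iff[OF h]
        by (rule exI[of _ "int j - int n"]) (simp add: p_def quad_node_def)
      then show ?thesis by simp
    qed
    have y1: "1 + y\<^sup>2 > 0" by (simp add: add_pos_nonneg)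
    \<comment> \<open>The periodic factor vanishes at the node, so only its derivative 2 pi/h, times
      1 - z^2 = 1 + y^2, survives in the derivative of \<open>D\<close>.\<close>
    have "residue F (p j) = G (p j) / of_real ((1 + y\<^sup>2) * (2 * pi / h))"
      unfolding F
    proof (rule residue_quotient_simple_zero[OF Gh Dh, where s="S - (pts - {p j})"])
      show "open (S - (pts - {p j}))" using S by (intro open_Diff finite_imp_closed) (auto simp: pts_def)
      show "p j \<in> S - (pts - {p j})" using ptsS that by (auto simp: pts_def)
      show "(D has_field_derivative of_real ((1 + y\<^sup>2) * (2 * pi / h))) (at (p j))"
        unfolding D_def using h e by (auto intro!: derivative_eq_intros simp: y power_mult_distrib)
      show "complex_of_real ((1 + y\<^sup>2) * (2 * pi / h)) \<noteq> 0"
        using y1 h by (simp only: of_real_eq_0_iff) simp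
    qed (use Dz e in \<open>auto simp: D_def\<close>)
    also have "\<dots> = quad_weight R h n j * \<phi> (p j)"
    proof -
      define E where "E = 1 - exp (- 2 * pi / h)"
      have "2 * E / ((1 + y\<^sup>2) * (2 * pi / h)) = E * h / (pi * (1 + y\<^sup>2))"
        using y1 h by (simp add: divide_simps)
      then have eq: "complex_of_real (2 * E) / of_real ((1 + y\<^sup>2) * (2 * pi / h)) = of_real (E * h / (pi * (1 + y\<^sup>2)))"
        by (metis of_real_divide)
      have swap: "a * b * c / d = b * e * a" if "c / d = e" for a b c d e :: complex
        unfolding that[symmetric] by simp
      show ?thesis
        unfolding G_def quad_weight_def y_def[symmetric] y E_def[symmetric]
        by (rule swap[OF eq])
    qed
    finally show "residue F (p j) = quad_weight R h n j * \<phi> (p j)" .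
  qed
  finally show "contour_integral (rectpath (Complex (-1/2) (-K)) (Complex R K)) F =
      2 * pi * \<i> * ((\<Sum>j<2*n+1. quad_weight R h n j * \<phi> (\<i> * of_real (quad_node h n j))) - \<phi> 1)"
    by (simp add: g_def p_def)
qed

text \<open>One bound \<open>M\<close> serves all four edges. The perimeter is at most 6(R + 1/2),
  and this 6 is cancelled by the factor 2 pi of the residue theorem.\<close>

lemma quadrature_error:
  fixes \<phi> :: "complex \<Rightarrow> complex" and h R \<eta> B :: real and n :: nat
  assumes \<phi>: "\<phi> holomorphic_on UNIV" and R: "2 \<le> R" and \<eta>: "0 \<le> \<eta>" and B: "0 \<le> B"
    and h: "h = 1 / (\<eta> + R + 1)" and n: "n = nat \<lceil>R / h\<rceil>"
    and \<phi>B: "\<And>z. cmod (\<phi> z) \<le> B * exp (\<eta> * max 0 (- Re z))"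
  shows "cmod (\<phi> 1 - (\<Sum>j<2*n+1. quad_weight R h n j * \<phi> (\<i> * of_real (quad_node h n j))))
     \<le> 3 * B * (R + 1/2) * exp (4 - R)"
proof -
  define K where "K = (real n + 1/2) * h"
  define Q where "Q = (\<lambda>z. 1 - exp (- 2 * of_real pi * z / of_real h) :: complex)"
  define Q1 where "Q1 = 1 - exp (- 2 * pi / h)"
  define F where "F = (\<lambda>z. \<phi> z * quad_kernel R z * of_real (2 * (1 - exp (- 2 * pi / h))) / ((1 - z\<^sup>2) * (1 - exp (- 2 * of_real pi * z / of_real h))))"
  \<comment> \<open>8/3 is 2 divided by the lower bound 3/4 for the modulus of 1 - z^2. The exponent
    13/4 = 2 + 5/4 is the one met on the horizontal edges.\<close>
  define M where "M = 8/3 * B * exp (13/4 - R)"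
  have h0: "0 < h" using R \<eta> by (simp add: h)
  have hi: "1 / h = \<eta> + R + 1" by (simp add: h)
  \<comment> \<open>Exactly what \<open>K \<le> R + 1/2\<close> asks for, since K is at most R +
    3h/2.\<close>
  have h1: "h \<le> 1/3" using R \<eta> unfolding h by (simp add: divide_simps)
  have nR: "R \<le> real n * h" "real n * h \<le> R + h"
  proof -
    have "0 \<le> R / h" using R h0 by simp
    then have "R / h \<le> real n" "real n \<le> R / h + 1" unfolding n by linarith+
    then show "R \<le> real n * h" "real n * h \<le> R + h" using h0 by (simp_all add: field_simps)
  qed
  have K: "R \<le> K" "K \<le> R + 1/2" using nR h1 h0 by (simp_all add: K_def algebra_simps)
  have Q1: "0 < Q1" "Q1 \<le> 1" using h0 by (auto simp: Q1_def)
  have M: "0 \<le> M" using B by (simp add: M_def)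
  \<comment> \<open>The parameter \<open>a\<close> divides the required decay between the kernel and
    the periodic factor. On the horizontal and right edges the kernel supplies all of it (a = 13/4 -
    R); on the left edge the kernel is only known to be at most e^3 and the periodic factor supplies
    the rest.\<close>
  have F_le: "cmod (F z) \<le> M"
    if z: "3/4 \<le> cmod (1 - z\<^sup>2)" and a: "cmod (quad_kernel R z) \<le> exp a" and b: "0 < cmod (Q z)"
      "cmod (\<phi> z) * Q1 \<le> B * exp (13/4 - R - a) * cmod (Q z)" for z a
  proof -
    have "cmod (F z) = (cmod (\<phi> z) * Q1 / cmod (Q z)) * cmod (quad_kernel R z) * (2 / cmod (1 - z\<^sup>2))"
    proof -
      have "F z = \<phi> z * quad_kernel R z * of_real (2 * Q1) / ((1 - z\<^sup>2) * Q z)"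
        by (simp add: F_def Q_def Q1_def)
      then show ?thesis using Q1 by (simp add: norm_mult norm_divide mult_ac)
    qed
    also have "\<dots> \<le> (B * exp (13/4 - R - a)) * exp a * (8/3)"
    proof (intro mult_mono)
      show "cmod (\<phi> z) * Q1 / cmod (Q z) \<le> B * exp (13/4 - R - a)"
        using b by (simp add: pos_divide_le_eq)
      show "2 / cmod (1 - z\<^sup>2) \<le> 8/3" using z by (subst pos_divide_le_eq) auto
    qed (use a B Q1 in auto)
    also have "\<dots> = M" by (simp add: M_def flip: exp_add)
    finally show ?thesis .
  qed
  have one_sq: "cmod (1 - z\<^sup>2) = cmod (1 - z) * cmod (1 + z)" for z :: complex
    by (simp add: power2_eq_square algebra_simps flip: norm_mult)
  have horiz: "cmod (F (Complex x y)) \<le> M" if x: "x \<in> {-1/2..R}" and y: "y = K \<or> y = - K" for x y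
  proof (rule F_le)
    let ?z = "Complex x y"
    have "1 * 1 \<le> cmod (1 - ?z) * cmod (1 + ?z)"
      using abs_Im_le_cmod[of "1 - ?z"] abs_Im_le_cmod[of "1 + ?z"] y K R by (intro mult_mono) auto
    then show "3/4 \<le> cmod (1 - ?z\<^sup>2)" unfolding one_sq by simp
    \<comment> \<open>For x >= 0 this uses x <= R. For -1/2 <= x < 0 the left side is at most 1/4,
      and 5/4 is chosen so that the right side is at least 1/4.\<close>
    have "x\<^sup>2 / R \<le> 2 * x + 5/4"
    proof (cases "0 \<le> x")
      case True
      then have "x * x \<le> x * R" using x by (intro mult_left_mono) auto
      then have "x\<^sup>2 / R \<le> x" using R by (simp add: power2_eq_square pos_divide_le_eq)
      then show ?thesis using True by linarith
    next
      case False
      then have "\<bar>x\<bar>\<^sup>2 \<le> (1/2)\<^sup>2" using x by (intro power_mono) auto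
      then have "x\<^sup>2 / R \<le> 1/4" using R by (simp add: power2_eq_square pos_divide_le_eq)
      moreover have "- 1/2 \<le> x" using x by simp
      ultimately show ?thesis by linarith
    qed
    moreover have "R \<le> y\<^sup>2 / R"
      using mult_mono[OF K(1) K(1)] K R y by (auto simp: power2_eq_square pos_le_divide_eq)
    moreover have "0 \<le> 1 / R" using R by simp
    moreover have "a - b - c - 2 * (x - 1) \<le> 13/4 - R" if "a \<le> 2 * x + 5/4" "R \<le> b" "0 \<le> c" for a b c
      using that by simp
    ultimately have "(x\<^sup>2 - y\<^sup>2 - 1) / R - 2 * (x - 1) \<le> 13/4 - R"
      unfolding diff_divide_distrib by blast
    then show "cmod (quad_kernel R ?z) \<le> exp (13/4 - R)" by (simp add: cmod_quad_kernel)
    \<comment> \<open>The 1/2 in \<open>K\<close> places the edge halfway between two nodes, where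
      the periodic exponential has phase -1. Then \<open>Q\<close> is 1 plus a positive number and
      no cancellation occurs.\<close>
    have odd: "exp (\<i> * of_real (- (2 * pi / h) * y)) = - 1"
    proof -
      have "(2 * pi / h) * K = pi * real (2 * n + 1)" using h0 by (simp add: K_def field_simps)
      then have "\<bar>- (2 * pi / h) * y\<bar> = pi * real (2 * n + 1)" using y h0 K R by (auto simp: abs_mult)
      moreover have "cos (pi * real (2 * n + 1)) = -1" "sin (pi * real (2 * n + 1)) = 0"
        unfolding cos_npi2 sin_npi2 by simp_all
      ultimately have "cos (- (2 * pi / h) * y) = - 1" "sin (- (2 * pi / h) * y) = 0"
        by (metis cos_abs_real, metis abs_real_def neg_equal_0_iff_equal sin_minus)
      then show ?thesis by (simp only: complex_eq_iff) (simp add: Re_exp Im_exp)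
    qed
    have "exp (- 2 * of_real pi * ?z / of_real h) = exp (of_real (- (2 * pi / h) * x)) * exp (\<i> * of_real (- (2 * pi / h) * y))"
    proof -
      have "- 2 * of_real pi * ?z / of_real h = of_real (- (2 * pi / h) * x) + \<i> * of_real (- (2 * pi / h) * y)"
        by (simp add: complex_eq_iff)
      then show ?thesis by (simp only: exp_add)
    qed
    then have Q: "Q ?z = of_real (1 + exp (- (2 * pi / h) * x))"
      unfolding odd Q_def by (simp flip: exp_of_real)
    have cQ: "cmod (Q ?z) = 1 + exp (- (2 * pi / h) * x)" unfolding Q norm_of_real by (simp add: add_pos_pos)
    then show "0 < cmod (Q ?z)" by (simp add: add_pos_pos)
    have "exp (\<eta> * max 0 (- x)) \<le> cmod (Q ?z)"
    proof (cases "0 \<le> x")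
      case False
      \<comment> \<open>Left of the axis the growth exp(\<eta> |x|) of \<open>\<phi>\<close> is
        absorbed by the exponential in \<open>Q\<close>.\<close>
      have "\<eta> \<le> 2 * pi / h" 
      proof -
        have "1 * \<eta> \<le> (2 * pi) * (1 / h)" using \<eta> R pi_gt3 unfolding hi by (intro mult_mono) auto
        then show ?thesis by simp
      qed
      then have "\<eta> * (- x) \<le> (2 * pi / h) * (- x)" using False by (intro mult_right_mono) auto
      then have "\<eta> * max 0 (- x) \<le> (2 * pi / h) * (- x)" using False by simp
      then have "exp (\<eta> * max 0 (- x)) \<le> exp (- (2 * pi / h) * x)" by simp
      then show ?thesis unfolding cQ by linarith
    qed (simp add: cQ)
    then have "B * exp (\<eta> * max 0 (- x)) * Q1 \<le> B * cmod (Q ?z) * 1"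
      using B Q1 by (intro mult_mono) (auto intro: mult_left_mono)
    moreover have "cmod (\<phi> ?z) * Q1 \<le> B * exp (\<eta> * max 0 (- x)) * Q1"
      using \<phi>B[of ?z] Q1 by (intro mult_right_mono) auto
    ultimately show "cmod (\<phi> ?z) * Q1 \<le> B * exp (13/4 - R - (13/4 - R)) * cmod (Q ?z)" by simp
  qed
  have right: "cmod (F (Complex R y)) \<le> M" for y
  proof (rule F_le)
    let ?z = "Complex R y"
    have "1 * 1 \<le> cmod (1 - ?z) * cmod (1 + ?z)"
      using abs_Re_le_cmod[of "1 - ?z"] abs_Re_le_cmod[of "1 + ?z"] R by (intro mult_mono) auto
    then show "3/4 \<le> cmod (1 - ?z\<^sup>2)" unfolding one_sq by simp
    have "R\<^sup>2 / R = R" "0 \<le> 1 / R" "0 \<le> y\<^sup>2 / R" using R by (auto simp: power2_eq_square)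
    moreover have "a - b - c - 2 * (R - 1) \<le> 13/4 - R" if "a = R" "0 \<le> c" "0 \<le> b" for a b c
      using that by simp
    ultimately have "(R\<^sup>2 - y\<^sup>2 - 1) / R - 2 * (R - 1) \<le> 13/4 - R"
      unfolding diff_divide_distrib by blast
    then show "cmod (quad_kernel R ?z) \<le> exp (13/4 - R)" by (simp add: cmod_quad_kernel)
    have "1 - exp (- (2 * pi / h) * R) \<le> cmod (Q ?z)"
      using norm_triangle_ineq2[of 1 "exp (- 2 * of_real pi * ?z / of_real h)"] unfolding Q_def by simp
    \<comment> \<open>Since R >= 1, the periodic quotient, normalised at z = 1, has modulus at most
      1 on this edge.\<close>
    moreover have "Q1 \<le> 1 - exp (- (2 * pi / h) * R)"
      using R h0 by (simp add: Q1_def pos_le_divide_eq divide_le_cancel)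
    ultimately have Q: "Q1 \<le> cmod (Q ?z)" by linarith
    then show "0 < cmod (Q ?z)" using Q1 by linarith
    have "cmod (\<phi> ?z) \<le> B" using \<phi>B[of ?z] R by simp
    then have "cmod (\<phi> ?z) * Q1 \<le> B * cmod (Q ?z)" using Q Q1 B by (intro mult_mono) auto
    then show "cmod (\<phi> ?z) * Q1 \<le> B * exp (13/4 - R - (13/4 - R)) * cmod (Q ?z)" by simp
  qed
  have left: "cmod (F (Complex (-1/2) y)) \<le> M" for y
  proof (rule F_le)
    let ?z = "Complex (-1/2) y"
    have "(3/2) * (1/2) \<le> cmod (1 - ?z) * cmod (1 + ?z)"
      using abs_Re_le_cmod[of "1 - ?z"] abs_Re_le_cmod[of "1 + ?z"] by (intro mult_mono) auto
    then show "3/4 \<le> cmod (1 - ?z\<^sup>2)" unfolding one_sq by simp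
    have "0 \<le> y\<^sup>2 / R" "(1/4 - 1) / R \<le> 0" using R by (auto simp: divide_le_0_iff)
    then have "((-1/2)\<^sup>2 - y\<^sup>2 - 1) / R - 2 * (-1/2 - 1) \<le> 3"
    proof -
      have "((-1/2)\<^sup>2 - y\<^sup>2 - 1) / R = (1/4 - 1) / R - y\<^sup>2 / R"
        unfolding diff_divide_distrib by (simp add: power2_eq_square)
      moreover have "a - 2 * (-1/2 - 1) \<le> 3" if "a = b - c" "b \<le> 0" "0 \<le> c" for a b c :: real
        using that by simp
      ultimately show ?thesis using \<open>0 \<le> y\<^sup>2 / R\<close> \<open>(1/4 - 1) / R \<le> 0\<close> by blast
    qed
    then show "cmod (quad_kernel R ?z) \<le> exp 3" by (simp add: cmod_quad_kernel)
    \<comment> \<open>Here \<eta>/2 matches the growth of \<open>\<phi>\<close> at Re z = -1/2 and R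
      is the decay wanted. The extra 1 in 1/h yields a factor e >= 2, which leaves room for
      subtracting 1 in the estimate of \<open>Q\<close>.\<close>
    have "1 * (\<eta>/2 + R + 1) \<le> pi * (1 / h)" unfolding hi using \<eta> R pi_gt3 by (intro mult_mono) auto
    then have "exp (\<eta>/2 + R) * exp 1 \<le> exp (pi / h)" by (simp flip: exp_add)
    moreover have "2 * exp (\<eta>/2 + R) \<le> exp (\<eta>/2 + R) * exp 1" using exp_ge_add_one_self[of 1] by simp
    moreover have "1 \<le> exp (\<eta>/2 + R)" using \<eta> R by simp
    moreover have "exp (pi / h) - 1 \<le> cmod (Q ?z)"
      using norm_triangle_ineq2[of "exp (- 2 * of_real pi * ?z / of_real h)" 1] unfolding Q_def
      by (simp add: norm_minus_commute)
    ultimately have Q: "exp (\<eta>/2 + R) \<le> cmod (Q ?z)" by linarith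
    then show "0 < cmod (Q ?z)" by (smt (verit) exp_gt_zero)
    have "cmod (\<phi> ?z) * Q1 \<le> (B * exp (\<eta> / 2)) * 1" using \<phi>B[of ?z] Q1 B by (intro mult_mono) auto
    also have "B * exp (\<eta> / 2) * 1 = B * exp (- R) * exp (\<eta>/2 + R)" by (simp flip: exp_add)
    also have "\<dots> \<le> B * exp (13/4 - R - 3) * cmod (Q ?z)" using Q B by (intro mult_mono) auto
    finally show "cmod (\<phi> ?z) * Q1 \<le> B * exp (13/4 - R - 3) * cmod (Q ?z)" .
  qed
  have "cmod (contour_integral (rectpath (Complex (-1/2) (-K)) (Complex R K)) F)
     \<le> 2 * M * (Re (Complex R K) - Re (Complex (-1/2) (-K))) + (M + M) * (Im (Complex R K) - Im (Complex (-1/2) (-K)))"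
  proof (rule contour_integral_rectpath_bound)
    show "continuous_on (path_image (rectpath (Complex (-1/2) (-K)) (Complex R K))) F"
      unfolding F_def K_def by (rule quadrature_contour_integral(1)[OF \<phi> h0 R])
  qed (use M K R in \<open>simp_all add: horiz right left[simplified]\<close>)
  also have "\<dots> \<le> 2 * M * (R + 1/2) + (M + M) * (2 * (R + 1/2))"
    using K M by (intro add_mono mult_left_mono) auto
  finally have *: "cmod (contour_integral (rectpath (Complex (-1/2) (-K)) (Complex R K)) F) \<le> 6 * M * (R + 1/2)"
    by (simp add: algebra_simps)
  define X where "X = (\<Sum>j<2*n+1. quad_weight R h n j * \<phi> (\<i> * of_real (quad_node h n j)))"
  have "contour_integral (rectpath (Complex (-1/2) (-K)) (Complex R K)) F = 2 * pi * \<i> * (X - \<phi> 1)"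
    unfolding F_def K_def X_def by (rule quadrature_contour_integral(2)[OF \<phi> h0 R])
  then have "2 * pi * cmod (\<phi> 1 - X) \<le> 6 * M * (R + 1/2)"
    using * by (simp add: norm_mult norm_minus_commute)
  moreover have "6 * cmod (\<phi> 1 - X) \<le> 2 * pi * cmod (\<phi> 1 - X)" using pi_gt3 by (intro mult_right_mono) auto
  ultimately have "cmod (\<phi> 1 - X) \<le> M * (R + 1/2)" by linarith
  also have "M \<le> 3 * B * exp (4 - R)" unfolding M_def using B by (intro mult_mono) auto
  then have "M * (R + 1/2) \<le> 3 * B * exp (4 - R) * (R + 1/2)" using R by (intro mult_right_mono) auto
  finally show ?thesis unfolding X_def[symmetric] by (simp only: mult_ac)
qed

text \<open>The kernel is at most e^2 on the imaginary axis, and the remaining factors are dominated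
  by a Riemann sum of the Cauchy density, at most 2 whatever \<open>h\<close> and \<open>n\<close>
  are.\<close>

lemma quad_weight_sum_le:
  assumes R: "2 \<le> R" and h: "0 < h" "h \<le> 1"
  shows "(\<Sum>j<2*n+1. cmod (quad_weight R h n j)) \<le> 2 * exp 2"
proof -
  have "cmod (quad_weight R h n j) \<le> exp 2 / pi * (h / (1 + (quad_node h n j)\<^sup>2))" for j
  proof -
    let ?y = "quad_node h n j"
    have "(- ?y\<^sup>2 - 1) / R \<le> 0"
      using R zero_le_power2[of ?y] by (intro divide_nonpos_pos) linarith+
    then have "cmod (quad_kernel R (\<i> * of_real ?y)) \<le> exp 2"
      by (simp add: cmod_quad_kernel)
    moreover have "\<bar>(1 - exp (- 2 * pi / h)) * h / (pi * (1 + ?y\<^sup>2))\<bar> \<le> h / (pi * (1 + ?y\<^sup>2))"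
    proof -
      have "(1 - exp (- 2 * pi / h)) * h \<le> 1 * h" using h by (intro mult_right_mono) auto
      moreover have "0 \<le> (1 - exp (- 2 * pi / h)) * h" using h by (intro mult_nonneg_nonneg) auto
      ultimately show ?thesis by (auto simp: abs_mult intro!: divide_right_mono)
    qed
    ultimately have "cmod (quad_weight R h n j) \<le> exp 2 * (h / (pi * (1 + ?y\<^sup>2)))"
      unfolding quad_weight_def norm_mult norm_of_real using h by (intro mult_mono) auto
    then show ?thesis by simp
  qed
  then have "(\<Sum>j<2*n+1. cmod (quad_weight R h n j)) \<le> (\<Sum>j<2*n+1. exp 2 / pi * (h / (1 + (quad_node h n j)\<^sup>2)))"
    by (intro sum_mono)
  also have "\<dots> = exp 2 / pi * (\<Sum>j<2*n+1. h / (1 + (quad_node h n j)\<^sup>2))"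
    by (simp only: sum_distrib_left)
  also have "(\<Sum>j<2*n+1. h / (1 + (quad_node h n j)\<^sup>2)) \<le> 2 * pi"
  proof -
    let ?S = "\<Sum>j\<in>{1..n}. h / (1 + (real j * h)\<^sup>2)"
    \<comment> \<open>Two mirror-image halves, each below pi/2 by the arctan bound, and the central
      node, which contributes \<open>h\<close>.\<close>
    have "{..<2*n+1} = {..<n} \<union> {n} \<union> {n+1..2*n}" by auto
    then have "(\<Sum>j<2*n+1. h / (1 + (quad_node h n j)\<^sup>2)) = 
       (\<Sum>j\<in>{..<n} \<union> {n} \<union> {n+1..2*n}. h / (1 + (quad_node h n j)\<^sup>2))" by simp
    also have "\<dots> = (\<Sum>j<n. h / (1 + (quad_node h n j)\<^sup>2)) + h
        + (\<Sum>j\<in>{n+1..2*n}. h / (1 + (quad_node h n j)\<^sup>2))"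
    proof -
      have disj: "({..<n} \<union> {n}) \<inter> {n+1..2*n} = {}" "{..<n} \<inter> {n} = {}" by auto
      show ?thesis
        by (subst sum.union_disjoint[OF _ _ disj(1)], simp, simp, subst sum.union_disjoint[OF _ _ disj(2)])
          (auto simp: quad_node_def)
    qed
    also have "(\<Sum>j<n. h / (1 + (quad_node h n j)\<^sup>2)) = ?S"
      by (rule sum.reindex_bij_witness[of _ "\<lambda>j. n - j" "\<lambda>j. n - j"])
        (auto simp: quad_node_def of_nat_diff power2_commute power_mult_distrib)
    also have "(\<Sum>j\<in>{n+1..2*n}. h / (1 + (quad_node h n j)\<^sup>2)) = ?S"
      by (rule sum.reindex_bij_witness[of _ "\<lambda>j. n + j" "\<lambda>j. j - n"])
        (auto simp: quad_node_def of_nat_diff)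
    finally have "(\<Sum>j<2*n+1. h / (1 + (quad_node h n j)\<^sup>2)) = 2 * ?S + h" by simp
    moreover have "?S \<le> pi / 2"
      using sum_recip_one_plus_square_le[of h n] arctan_ubound[of "real n * h"] h by linarith
    ultimately show ?thesis using h pi_gt3 by linarith
  qed
  then have "exp 2 / pi * (\<Sum>j<2*n+1. h / (1 + (quad_node h n j)\<^sup>2)) \<le> exp 2 / pi * (2 * pi)"
    by (intro mult_left_mono) auto
  finally show ?thesis by simp
qed

section \<open>Linear flows depending on a complex parameter\<close>

text \<open>Polynomials in z whose coefficients are continuous functions of t, in Horner form;
  values outside \<open>{0..T}\<close> are left free. The inductive form turns each closure property
  of the Dyson terms into an induction that never mentions degrees.\<close>

inductive poly_family :: "real \<Rightarrow> (complex \<Rightarrow> real \<Rightarrow> complex) \<Rightarrow> bool" for T where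
  const: "continuous_on {0..T} p \<Longrightarrow> (\<And>z t. t \<in> {0..T} \<Longrightarrow> f z t = p t) \<Longrightarrow> poly_family T f"
| step: "poly_family T g \<Longrightarrow> poly_family T h \<Longrightarrow> (\<And>z t. t \<in> {0..T} \<Longrightarrow> f z t = g z t + z * h z t)
    \<Longrightarrow> poly_family T f"

lemma poly_family_continuous: "poly_family T f \<Longrightarrow> continuous_on {0..T} (f z)"
proof (induction rule: poly_family.induct)
  case (const p f)
  then show ?case by (intro continuous_on_eq[OF const(1)]) auto
next
  case (step g h f)
  have "continuous_on {0..T} (\<lambda>t. g z t + z * h z t)" using step by (intro continuous_intros)
  then show ?case by (rule continuous_on_eq) (simp add: step)
qed

lemma poly_family_holomorphic:
  assumes "poly_family T f" "t \<in> {0..T}"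
  shows "(\<lambda>z. f z t) holomorphic_on A"
  using assms by (induction rule: poly_family.induct) (auto intro!: holomorphic_intros)

lemma poly_family_add:
  assumes "poly_family T f" "poly_family T g"
  shows "poly_family T (\<lambda>z t. f z t + g z t)"
  using assms
proof (induction rule: poly_family.induct)
  case (const p f)
  from const(3,1,2) show ?case
  proof (induction rule: poly_family.induct)
    case (const q g)
    then show ?case
      by (intro poly_family.const[of T "\<lambda>t. p t + q t"]) (auto intro!: continuous_intros)
  next
    case (step g1 g2 g)
    show ?case by (rule poly_family.step[of T "\<lambda>z t. f z t + g1 z t" g2]) (use step in auto)
  qed
next
  case (step f1 f2 f)
  show ?case by (rule poly_family.step[of T "\<lambda>z t. f1 z t + g z t" f2]) (use step in auto)
qed

lemma poly_family_mult_continuous: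
  assumes "poly_family T f" "continuous_on {0..T} b"
  shows "poly_family T (\<lambda>z t. b t * f z t)"
  using assms
proof (induction rule: poly_family.induct)
  case (const p f)
  then show ?case by (intro poly_family.const[of T "\<lambda>t. b t * p t"]) (auto intro!: continuous_intros)
next
  case (step g h f)
  show ?case
    by (rule poly_family.step[of T "\<lambda>z t. b t * g z t" "\<lambda>z t. b t * h z t"]) (use step in \<open>auto simp: algebra_simps\<close>)
qed

lemma poly_family_sum:
  "(\<And>k. k \<in> A \<Longrightarrow> poly_family T (f k)) \<Longrightarrow> poly_family T (\<lambda>z t. \<Sum>k\<in>A. f k z t)"
  by (induction A rule: infinite_finite_induct)
    (auto intro!: poly_family_add intro: poly_family.const[of T "\<lambda>_. 0"])

text \<open>Integrating coefficient by coefficient stays in the class. This closes the Dyson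
  recursion and makes every term entire in z without differentiating under the integral
  sign.\<close>

lemma poly_family_integral:
  assumes "poly_family T f"
  shows "poly_family T (\<lambda>z t. - integral {0..t} (f z))"
  using assms
proof (induction rule: poly_family.induct)
  case (const p f)
  then show ?case
    by (intro poly_family.const[of T "\<lambda>t. - integral {0..t} p"])
      (auto intro!: continuous_intros indefinite_integral_continuous_1 integrable_continuous_real integral_cong)
next
  case (step g h f)
  show ?case
  proof (rule poly_family.step[OF step.IH])
    fix z t assume t: "t \<in> {0..T}"
    have "g z integrable_on {0..t}" "h z integrable_on {0..t}"
      using t step.hyps(1,2) 
      by (auto intro!: integrable_continuous_real continuous_on_subset[OF poly_family_continuous])
    moreover have "integral {0..t} (f z) = integral {0..t} (\<lambda>s. g z s + z * h z s)"
      using t step.hyps by (intro integral_cong) auto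
    ultimately show "- integral {0..t} (f z) = - integral {0..t} (g z) + z * - integral {0..t} (h z)"
      using integral_unique[OF has_integral_add[OF integrable_integral has_integral_mult_right[OF integrable_integral]], of "g z" "{0..t}" "h z" z]
      by simp
  qed
qed

text \<open>Terms of the Dyson series of the flow of \<open>y' = - (B0 t + z B1 t) y\<close>, \<open>y 0 = v\<close>, in coordinates.\<close>
primrec dyson :: "nat \<Rightarrow> (real \<Rightarrow> nat \<Rightarrow> nat \<Rightarrow> complex) \<Rightarrow> (real \<Rightarrow> nat \<Rightarrow> nat \<Rightarrow> complex) \<Rightarrow>
    (nat \<Rightarrow> complex) \<Rightarrow> nat \<Rightarrow> complex \<Rightarrow> real \<Rightarrow> nat \<Rightarrow> complex" where
  "dyson N B0 B1 v 0 = (\<lambda>z t i. v i)"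
| "dyson N B0 B1 v (Suc n) = (\<lambda>z t i. - integral {0..t}
     (\<lambda>s. \<Sum>k<N. (B0 s i k + z * B1 s i k) * dyson N B0 B1 v n z s k))"

definition lin_flow :: "nat \<Rightarrow> (real \<Rightarrow> nat \<Rightarrow> nat \<Rightarrow> complex) \<Rightarrow> (real \<Rightarrow> nat \<Rightarrow> nat \<Rightarrow> complex) \<Rightarrow>
    (nat \<Rightarrow> complex) \<Rightarrow> complex \<Rightarrow> real \<Rightarrow> nat \<Rightarrow> complex" where
  "lin_flow N B0 B1 v z t i = (\<Sum>n. dyson N B0 B1 v n z t i)"

lemma dyson_majorant_summable: "summable (\<lambda>n. V * (K::real) ^ n / fact n)"
  using summable_mult[OF summable_exp[of K], of V] by (simp add: field_simps)

lemma finite_family_bounded: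
  fixes v :: "nat \<Rightarrow> complex"
  shows "\<exists>V\<ge>0. \<forall>i<N. cmod (v i) \<le> V"
  by (rule exI[of _ "\<Sum>i<N. cmod (v i)"]) (auto intro!: sum_nonneg member_le_sum[of _ "{..<N}" "\<lambda>i. cmod (v i)"])

lemma lin_flow_initial: "lin_flow N B0 B1 v z 0 i = v i"
proof -
  have "dyson N B0 B1 v n z 0 i = (if n = 0 then v i else 0)" for n by (cases n) auto
  then show ?thesis unfolding lin_flow_def using suminf_finite[of "{0}" "\<lambda>n. if n = 0 then v i else 0"] by simp
qed

context
  fixes N :: nat and T :: real and B0 B1 :: "real \<Rightarrow> nat \<Rightarrow> nat \<Rightarrow> complex" and v :: "nat \<Rightarrow> complex"
  assumes B0: "\<And>i k. i < N \<Longrightarrow> k < N \<Longrightarrow> continuous_on {0..T} (\<lambda>t. B0 t i k)"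
    and B1: "\<And>i k. i < N \<Longrightarrow> k < N \<Longrightarrow> continuous_on {0..T} (\<lambda>t. B1 t i k)"
begin

lemma dyson_poly_family: "i < N \<Longrightarrow> poly_family T (\<lambda>z t. dyson N B0 B1 v n z t i)"
proof (induction n arbitrary: i)
  case 0
  then show ?case by (auto intro: poly_family.const[of T "\<lambda>_. v i"])
next
  case (Suc n)
  have "poly_family T (\<lambda>z t. (B0 t i k + z * B1 t i k) * dyson N B0 B1 v n z t k)" if "k < N" for k
    by (rule poly_family.step[OF poly_family_mult_continuous[OF Suc.IH[OF that] B0[OF Suc.prems that]]
          poly_family_mult_continuous[OF Suc.IH[OF that] B1[OF Suc.prems that]]]) (simp add: algebra_simps)
  then show ?case by (auto intro!: poly_family_integral poly_family_sum)
qed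

lemmas dyson_continuous = poly_family_continuous[OF dyson_poly_family]

lemma dyson_integrand_continuous:
  "i < N \<Longrightarrow> continuous_on {0..T} (\<lambda>s. \<Sum>k<N. (B0 s i k + z * B1 s i k) * dyson N B0 B1 v n z s k)"
  by (auto intro!: continuous_intros B0 B1 dyson_continuous)

text \<open>Each iterated integral raises the power of t and divides by its index;
  \<open>real N * C\<close> is a crude row sum bound. Only a bound \<open>C\<close> on the
  coefficients enters, so the estimate is uniform over any set of z sharing that
  \<open>C\<close>.\<close>

lemma dyson_bound:
  assumes C: "\<And>t i k. t \<in> {0..T} \<Longrightarrow> i < N \<Longrightarrow> k < N \<Longrightarrow> cmod (B0 t i k + z * B1 t i k) \<le> C" "0 \<le> C"
    and V: "\<And>i. i < N \<Longrightarrow> cmod (v i) \<le> V" and "0 \<le> V"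
  shows "t \<in> {0..T} \<Longrightarrow> i < N \<Longrightarrow> cmod (dyson N B0 B1 v n z t i) \<le> V * (real N * C * t) ^ n / fact n"
proof (induction n arbitrary: t i)
  case (Suc n)
  let ?f = "\<lambda>s. \<Sum>k<N. (B0 s i k + z * B1 s i k) * dyson N B0 B1 v n z s k"
  let ?g = "\<lambda>s. real N * C * V * (real N * C * s) ^ n / fact n"
  have "cmod (integral {0..t} ?f) \<le> integral {0..t} ?g"
  proof (rule integral_norm_bound_integral)
    show "?f integrable_on {0..t}"
      using Suc.prems by (intro integrable_continuous_real continuous_on_subset[OF dyson_integrand_continuous]) auto
    show "?g integrable_on {0..t}" by (intro integrable_continuous_real continuous_intros) auto
    fix s assume s: "s \<in> {0..t}"
    have "cmod (?f s) \<le> (\<Sum>k<N. C * (V * (real N * C * s) ^ n / fact n))"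
    proof (intro order.trans[OF norm_sum] sum_mono)
      fix k assume "k \<in> {..<N}"
      then have "cmod (B0 s i k + z * B1 s i k) \<le> C" "cmod (dyson N B0 B1 v n z s k) \<le> V * (real N * C * s) ^ n / fact n"
        using s Suc.prems by (auto intro!: C(1) Suc.IH)
      then show "cmod ((B0 s i k + z * B1 s i k) * dyson N B0 B1 v n z s k) \<le> C * (V * (real N * C * s) ^ n / fact n)"
        unfolding norm_mult using \<open>0 \<le> C\<close> by (intro mult_mono) auto
    qed
    then show "cmod (?f s) \<le> ?g s" by (simp add: mult_ac)
  qed
  also have "integral {0..t} ?g = V * (real N * C * t) ^ Suc n / fact (Suc n)"
  proof -
    have "(?g has_integral (V * (real N * C * t) ^ Suc n / fact (Suc n) - V * (real N * C * 0) ^ Suc n / fact (Suc n))) {0..t}"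
    proof (rule fundamental_theorem_of_calculus)
      show "0 \<le> t" using Suc.prems by auto
      fix s assume "s \<in> {0..t}"
      have "((\<lambda>s. V * (real N * C * s) ^ Suc n / fact (Suc n)) has_real_derivative
          V * (real (Suc n) * (real N * C * s) ^ n * (real N * C)) / fact (Suc n)) (at s within {0..t})"
        by (rule derivative_eq_intros refl | simp)+
      also have "V * (real (Suc n) * (real N * C * s) ^ n * (real N * C)) / fact (Suc n) = ?g s"
        by (simp add: field_simps del: of_nat_Suc)
      finally show "((\<lambda>s. V * (real N * C * s) ^ Suc n / fact (Suc n)) has_vector_derivative ?g s) (at s within {0..t})"
        by (simp add: has_real_derivative_iff_has_vector_derivative)
    qed
    from integral_unique[OF this] show ?thesis
      by (simp only: mult_zero_right power_0_Suc div_0 diff_zero)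
  qed
  finally show ?case by simp
qed (use V in auto)

text \<open>Uniformity over the disc is what makes the Dyson series converge locally uniformly in z,
  hence to a holomorphic function.\<close>

lemma lin_coeff_bounded:
  "\<exists>C\<ge>0. \<forall>z t i k. cmod z \<le> r \<longrightarrow> t \<in> {0..T} \<longrightarrow> i < N \<longrightarrow> k < N \<longrightarrow> cmod (B0 t i k + z * B1 t i k) \<le> C"
proof -
  have ex: "\<exists>c\<ge>0. \<forall>t\<in>{0..T}. \<forall>i<N. \<forall>k<N. cmod (B t i k) \<le> c"
    if B: "\<And>i k. i < N \<Longrightarrow> k < N \<Longrightarrow> continuous_on {0..T} (\<lambda>t. B t i k)" for B :: "real \<Rightarrow> nat \<Rightarrow> nat \<Rightarrow> complex"
  proof -
    have "\<exists>c. \<forall>t\<in>{0..T}. cmod (B t i k) \<le> c" if "i < N" "k < N" for i k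
      using compact_imp_bounded[OF compact_continuous_image[OF B[OF that] compact_Icc]] by (auto simp: bounded_iff)
    then obtain c where c: "\<And>i k t. i < N \<Longrightarrow> k < N \<Longrightarrow> t \<in> {0..T} \<Longrightarrow> cmod (B t i k) \<le> c i k" by metis
    have "cmod (B t i k) \<le> (\<Sum>i<N. \<Sum>k<N. \<bar>c i k\<bar>)" if "t \<in> {0..T}" "i < N" "k < N" for t i k
    proof -
      have "cmod (B t i k) \<le> \<bar>c i k\<bar>" using c[of i k t] that by auto
      also have "\<dots> \<le> (\<Sum>k<N. \<bar>c i k\<bar>)" using that by (intro member_le_sum[of k "{..<N}" "\<lambda>k. \<bar>c i k\<bar>"]) auto
      also have "\<dots> \<le> (\<Sum>i<N. \<Sum>k<N. \<bar>c i k\<bar>)"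
        using that by (intro member_le_sum[of i "{..<N}" "\<lambda>i. \<Sum>k<N. \<bar>c i k\<bar>"]) (auto intro: sum_nonneg)
      finally show ?thesis .
    qed
    then show ?thesis by (intro exI[of _ "\<Sum>i<N. \<Sum>k<N. \<bar>c i k\<bar>"]) (auto intro!: sum_nonneg)
  qed
  have e0: "\<exists>c\<ge>0. \<forall>t\<in>{0..T}. \<forall>i<N. \<forall>k<N. cmod (B0 t i k) \<le> c" by (rule ex) (rule B0)
  have e1: "\<exists>c\<ge>0. \<forall>t\<in>{0..T}. \<forall>i<N. \<forall>k<N. cmod (B1 t i k) \<le> c" by (rule ex) (rule B1)
  obtain c0 where c0: "0 \<le> c0" "\<forall>t\<in>{0..T}. \<forall>i<N. \<forall>k<N. cmod (B0 t i k) \<le> c0" using e0 by blast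
  obtain c1 where c1: "0 \<le> c1" "\<forall>t\<in>{0..T}. \<forall>i<N. \<forall>k<N. cmod (B1 t i k) \<le> c1" using e1 by blast
  have "cmod (B0 t i k + z * B1 t i k) \<le> c0 + \<bar>r\<bar> * c1" if "cmod z \<le> r" "t \<in> {0..T}" "i < N" "k < N" for z t i k
    using that c0 c1 by (intro order.trans[OF norm_triangle_ineq] add_mono) (auto simp: norm_mult intro!: mult_mono)
  moreover have "0 \<le> c0 + \<bar>r\<bar> * c1" using c0 c1 by simp
  ultimately show ?thesis by blast
qed

lemma lin_flow_holomorphic:
  assumes "t \<in> {0..T}" "i < N"
  shows "(\<lambda>z. lin_flow N B0 B1 v z t i) holomorphic_on UNIV"
proof (rule holomorphic_uniform_sequence[where f = "\<lambda>n z. \<Sum>m<n. dyson N B0 B1 v m z t i"])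
  show "(\<lambda>z. \<Sum>m<n. dyson N B0 B1 v m z t i) holomorphic_on UNIV" for n
    by (intro holomorphic_on_sum poly_family_holomorphic[OF dyson_poly_family] assms)
  fix x :: complex
  obtain C where C: "0 \<le> C" "\<And>z t i k. cmod z \<le> cmod x + 1 \<Longrightarrow> t \<in> {0..T} \<Longrightarrow> i < N \<Longrightarrow> k < N \<Longrightarrow> cmod (B0 t i k + z * B1 t i k) \<le> C"
    using lin_coeff_bounded[of "cmod x + 1"] by metis
  obtain V where V: "0 \<le> V" "\<And>i. i < N \<Longrightarrow> cmod (v i) \<le> V" using finite_family_bounded by metis
  have ul: "uniform_limit (cball x 1) (\<lambda>n z. \<Sum>m<n. dyson N B0 B1 v m z t i) (\<lambda>z. lin_flow N B0 B1 v z t i) sequentially"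
    unfolding lin_flow_def
  proof (rule Weierstrass_m_test)
    fix n and z :: complex assume "z \<in> cball x 1"
    then have "cmod z \<le> cmod x + 1" using norm_triangle_sub[of z x] by (simp add: dist_norm norm_minus_commute)
    then show "cmod (dyson N B0 B1 v n z t i) \<le> V * (real N * C * t) ^ n / fact n"
      using assms C V by (intro dyson_bound) auto
  qed (rule dyson_majorant_summable)
  show "\<exists>d>0. cball x d \<subseteq> UNIV \<and> uniform_limit (cball x d) (\<lambda>n z. \<Sum>m<n. dyson N B0 B1 v m z t i)
      (\<lambda>z. lin_flow N B0 B1 v z t i) sequentially" by (intro exI[of _ "1::real"] conjI ul subset_UNIV) simp
qed simp

text \<open>The series is not differentiated term by term. The integrands converge uniformly on
  \<open>{0..T}\<close>, so summing the recursion gives the Volterra equation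
  \<open>y = v - integral G\<close> with \<open>G\<close> continuous, and the fundamental theorem of
  calculus finishes.\<close>

lemma lin_flow_derivative:
  assumes t: "t \<in> {0..T}" and i: "i < N"
  shows "((\<lambda>s. lin_flow N B0 B1 v z s i) has_vector_derivative
     - (\<Sum>k<N. (B0 t i k + z * B1 t i k) * lin_flow N B0 B1 v z t k)) (at t within {0..T})"
proof -
  obtain C where C: "0 \<le> C" "\<And>t i k. t \<in> {0..T} \<Longrightarrow> i < N \<Longrightarrow> k < N \<Longrightarrow> cmod (B0 t i k + z * B1 t i k) \<le> C"
    using lin_coeff_bounded[of "cmod z"] by (metis order_refl)
  obtain V where V: "0 \<le> V" "\<And>i. i < N \<Longrightarrow> cmod (v i) \<le> V" using finite_family_bounded by metis
  have bd: "cmod (dyson N B0 B1 v n z s k) \<le> V * (real N * C * T) ^ n / fact n" if "s \<in> {0..T}" "k < N" for n s k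
  proof -
    have "cmod (dyson N B0 B1 v n z s k) \<le> V * (real N * C * s) ^ n / fact n"
      using that C V by (intro dyson_bound) auto
    also have "\<dots> \<le> V * (real N * C * T) ^ n / fact n"
      using that C V by (intro divide_right_mono mult_left_mono power_mono) auto
    finally show ?thesis .
  qed
  have summ: "summable (\<lambda>n. dyson N B0 B1 v n z s k)" if "s \<in> {0..T}" "k < N" for s k
    using bd[OF that] by (rule summable_comparison_test'[OF dyson_majorant_summable, where N=0])
  define b where "b = (\<lambda>s k. B0 s i k + z * B1 s i k)"
  define g where "g = (\<lambda>n s. \<Sum>k<N. b s k * dyson N B0 B1 v n z s k)"
  define G where "G = (\<lambda>s. \<Sum>k<N. b s k * lin_flow N B0 B1 v z s k)"
  have gc: "continuous_on {0..T} (g n)" for n unfolding g_def b_def by (rule dyson_integrand_continuous[OF i])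
  have sG: "(\<Sum>n. g n s) = G s" if "s \<in> {0..T}" for s
  proof -
    have "(\<Sum>n. g n s) = (\<Sum>k<N. \<Sum>n. b s k * dyson N B0 B1 v n z s k)"
      unfolding g_def using that by (intro suminf_sum summable_mult summ) auto
    also have "\<dots> = G s" unfolding G_def lin_flow_def
      using that by (intro sum.cong refl suminf_mult summ) auto
    finally show ?thesis .
  qed
  have ul: "uniform_limit {0..T} (\<lambda>n s. \<Sum>m<n. g m s) G sequentially"
  proof -
    have "uniform_limit {0..T} (\<lambda>n s. \<Sum>m<n. g m s) (\<lambda>s. \<Sum>n. g n s) sequentially"
    proof (rule Weierstrass_m_test)
      fix n s assume s: "s \<in> {0..T}"
      have "cmod (g n s) \<le> (\<Sum>k<N. C * (V * (real N * C * T) ^ n / fact n))"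
        unfolding g_def b_def
      proof (intro order.trans[OF norm_sum] sum_mono)
        fix k assume "k \<in> {..<N}"
        then have "cmod (B0 s i k + z * B1 s i k) \<le> C" "cmod (dyson N B0 B1 v n z s k) \<le> V * (real N * C * T) ^ n / fact n"
          using s i by (auto intro!: C(2) bd)
        then show "cmod ((B0 s i k + z * B1 s i k) * dyson N B0 B1 v n z s k) \<le> C * (V * (real N * C * T) ^ n / fact n)"
          unfolding norm_mult using C(1) by (intro mult_mono) auto
      qed
      also have "\<dots> = (real N * C * V) * (real N * C * T) ^ n / fact n" by simp
      finally show "cmod (g n s) \<le> (real N * C * V) * (real N * C * T) ^ n / fact n" .
    qed (rule dyson_majorant_summable)
    then show ?thesis by (rule uniform_limit_cong'[THEN iffD1, rotated 2]) (auto simp: sG)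
  qed
  have Gc: "continuous_on {0..T} G"
    by (rule uniform_limit_theorem[OF _ ul]) (auto intro!: always_eventually continuous_intros gc)
  have eq: "lin_flow N B0 B1 v z s i = v i - integral {0..s} G" if s: "s \<in> {0..T}" for s
  proof -
    have sub: "{0..s} \<subseteq> {0..T}" using s by auto
    have gs: "continuous_on {0..s} (\<lambda>s. \<Sum>m<n. g m s)" for n
      by (intro continuous_on_sum continuous_on_subset[OF gc sub])
    obtain I J where IJ: "\<And>n. ((\<lambda>s. \<Sum>m<n. g m s) has_integral I n) {0..s}" "(G has_integral J) {0..s}" "I \<longlonglongrightarrow> J"
      by (rule uniform_limit_integral[OF uniform_limit_on_subset[OF ul sub] gs]) auto
    have "I n = (\<Sum>m<n. integral {0..s} (g m))" for n
    proof -
      have "I n = integral {0..s} (\<lambda>s. \<Sum>m<n. g m s)" by (rule integral_unique[OF IJ(1), symmetric])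
      also have "\<dots> = (\<Sum>m<n. integral {0..s} (g m))"
        by (intro integral_sum integrable_continuous_real continuous_on_subset[OF gc sub]) auto
      finally show ?thesis .
    qed
    \<comment> \<open>Peeling off the zeroth term leaves \<open>v i\<close>; the term of index m+1
      is minus the integral of \<open>g m\<close>.\<close>
    then have "(\<Sum>m<Suc n. dyson N B0 B1 v m z s i) = v i - I n" for n
      by (simp add: sum.lessThan_Suc_shift g_def b_def sum_negf del: sum.lessThan_Suc)
    moreover have "(\<lambda>n. \<Sum>m<Suc n. dyson N B0 B1 v m z s i) \<longlonglongrightarrow> lin_flow N B0 B1 v z s i"
      unfolding lin_flow_def using LIMSEQ_Suc[OF summable_LIMSEQ[OF summ[OF s i]]] .
    ultimately have "(\<lambda>n. v i - I n) \<longlonglongrightarrow> lin_flow N B0 B1 v z s i" by simp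
    moreover have "(\<lambda>n. v i - I n) \<longlonglongrightarrow> v i - J" using IJ(3) by (intro tendsto_intros)
    ultimately show ?thesis using IJ(2) LIMSEQ_unique by (metis integral_unique)
  qed
  have "((\<lambda>s. v i - integral {0..s} G) has_vector_derivative 0 - G t) (at t within {0..T})"
    by (intro has_vector_derivative_diff has_vector_derivative_const integral_has_vector_derivative[OF Gc t])
  then have "((\<lambda>s. lin_flow N B0 B1 v z s i) has_vector_derivative 0 - G t) (at t within {0..T})"
    by (rule has_vector_derivative_transform[OF t, rotated]) (simp add: eq)
  then show ?thesis by (simp add: G_def b_def)
qed

end

section \<open>The largest eigenvalue as a Rayleigh supremum\<close>

text \<open>A sesquilinear form, conjugate-linear in \<open>x\<close>. Vectors are functions on
  \<open>nat\<close> read only below \<open>N\<close>, which spares carrier conditions in the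
  estimates.\<close>

definition sform :: "nat \<Rightarrow> (nat \<Rightarrow> nat \<Rightarrow> complex) \<Rightarrow> (nat \<Rightarrow> complex) \<Rightarrow> (nat \<Rightarrow> complex) \<Rightarrow> complex" where
  "sform N M x y = (\<Sum>i<N. \<Sum>k<N. cnj (x i) * M i k * y k)"

definition normsq :: "nat \<Rightarrow> (nat \<Rightarrow> complex) \<Rightarrow> real" where
  "normsq N w = (\<Sum>i<N. (cmod (w i))\<^sup>2)"

definition rayleigh_sup :: "nat \<Rightarrow> (nat \<Rightarrow> nat \<Rightarrow> complex) \<Rightarrow> real" where
  "rayleigh_sup N M = (SUP w \<in> {w. normsq N w = 1}. Re (sform N M w w))"

lemma normsq_nonneg [simp]: "0 \<le> normsq N w"
  by (simp add: normsq_def sum_nonneg)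

lemma normsq_0_iff: "normsq N w = 0 \<longleftrightarrow> (\<forall>i<N. w i = 0)"
  by (auto simp: normsq_def sum_nonneg_eq_0_iff)

lemma cmod_sq_le_normsq: "i < N \<Longrightarrow> (cmod (w i))\<^sup>2 \<le> normsq N w"
  unfolding normsq_def by (rule member_le_sum[of i "{..<N}" "\<lambda>i. (cmod (w i))\<^sup>2"]) auto

lemma normsq_scale: "normsq N (\<lambda>i. c * w i) = (cmod c)\<^sup>2 * normsq N w"
  by (simp add: normsq_def norm_mult power_mult_distrib sum_distrib_left)

lemma sform_scale: "sform N M (\<lambda>i. of_real c * x i) (\<lambda>i. of_real c * y i) = of_real (c\<^sup>2) * sform N M x y"
  by (simp add: sform_def sum_distrib_left power2_eq_square mult_ac)

lemma sform_diff_left: "sform N M (\<lambda>i. x i - x' i) y = sform N M x y - sform N M x' y"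
  by (simp add: sform_def ring_distribs sum_subtractf)

lemma sform_diff_right: "sform N M x (\<lambda>i. y i - y' i) = sform N M x y - sform N M x y'"
  by (simp add: sform_def ring_distribs sum_subtractf)

lemma sform_diff_mat: "sform N (\<lambda>i k. M i k - M' i k) x y = sform N M x y - sform N M' x y"
  by (simp add: sform_def ring_distribs sum_subtractf)

lemma sform_scale_left: "sform N M (\<lambda>i. of_real c * x i) y = of_real c * sform N M x y"
  by (simp add: sform_def sum_distrib_left mult_ac)

lemma sform_scale_right: "sform N M x (\<lambda>i. c * y i) = c * sform N M x y"
  by (simp add: sform_def sum_distrib_left mult_ac)

lemma sform_eq: "sform N M x y = (\<Sum>i<N. cnj (x i) * (\<Sum>k<N. M i k * y k))"
  by (simp add: sform_def sum_distrib_left mult_ac)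

lemma sform_self_eq: "(\<Sum>i<N. cnj (w i) * w i) = of_real (normsq N w)"
  by (simp add: normsq_def complex_norm_square mult_ac del: of_real_power)

lemma cnj_sform:
  assumes "\<And>i k. i < N \<Longrightarrow> k < N \<Longrightarrow> cnj (M i k) = M k i"
  shows "cnj (sform N M x y) = sform N M y x"
proof -
  have "cnj (sform N M x y) = (\<Sum>i<N. \<Sum>k<N. cnj (y k) * M k i * x i)"
    using assms by (auto simp: sform_def mult_ac intro!: sum.cong)
  also have "\<dots> = sform N M y x" unfolding sform_def by (rule sum.swap)
  finally show ?thesis .
qed

lemma Im_sform_hermitian:
  assumes "\<And>i k. i < N \<Longrightarrow> k < N \<Longrightarrow> cnj (M i k) = M k i"
  shows "Im (sform N M w w) = 0"
  using cnj_sform[of N M w w] assms by (simp add: complex_eq_iff)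

lemma cmod_sform_le: "cmod (sform N M w w) \<le> (\<Sum>i<N. \<Sum>k<N. cmod (M i k)) * normsq N w"
proof -
  have "cmod (cnj (w i) * M i k * w k) \<le> cmod (M i k) * normsq N w" if "i < N" "k < N" for i k
  proof -
    have "2 * (cmod (w i) * cmod (w k)) \<le> (cmod (w i))\<^sup>2 + (cmod (w k))\<^sup>2"
      using sum_squares_bound[of "cmod (w i)" "cmod (w k)"] by simp
    then have "cmod (w i) * cmod (w k) \<le> normsq N w"
      using cmod_sq_le_normsq[OF that(1), of w] cmod_sq_le_normsq[OF that(2), of w] by linarith
    then have "cmod (M i k) * (cmod (w i) * cmod (w k)) \<le> cmod (M i k) * normsq N w" by (intro mult_left_mono) auto
    then show ?thesis by (simp add: norm_mult mult_ac)
  qed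
  then show ?thesis unfolding sform_def sum_distrib_right
    by (intro order.trans[OF norm_sum] sum_mono) auto
qed

lemma rayleigh_bdd: "bdd_above ((\<lambda>w. Re (sform N M w w)) ` {w. normsq N w = 1})"
proof (rule bdd_aboveI2)
  fix w assume "w \<in> {w. normsq N w = 1}"
  then show "Re (sform N M w w) \<le> (\<Sum>i<N. \<Sum>k<N. cmod (M i k))"
    using cmod_sform_le[of N M w] complex_Re_le_cmod[of "sform N M w w"] by simp
qed

lemma unit_exists: "0 < N \<Longrightarrow> \<exists>w. normsq N w = 1"
  by (rule exI[of _ "\<lambda>i. if i = 0 then 1 else 0"]) (simp add: normsq_def if_distrib[of "\<lambda>x. (cmod x)\<^sup>2"] cong: if_cong)

lemma Re_sform_le_rayleigh_sup: "Re (sform N M w w) \<le> rayleigh_sup N M * normsq N w"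
proof (cases "normsq N w = 0")
  case True
  then have "\<forall>i<N. w i = 0" by (simp add: normsq_0_iff)
  then show ?thesis using True by (simp add: sform_def)
next
  case False
  then have pos: "0 < normsq N w" using normsq_nonneg[of N w] by linarith
  define c where "c = 1 / sqrt (normsq N w)"
  have c: "c\<^sup>2 = 1 / normsq N w" using pos by (simp add: c_def power_divide)
  let ?u = "\<lambda>i. of_real c * w i"
  have "normsq N ?u = 1" using pos c by (simp add: normsq_scale)
  then have "Re (sform N M ?u ?u) \<le> rayleigh_sup N M"
    unfolding rayleigh_sup_def by (intro cSUP_upper2[OF rayleigh_bdd]) auto
  then show ?thesis using pos unfolding sform_scale c by (simp add: field_simps)
qed

lemma rayleigh_sup_least:
  assumes "0 < N" "\<And>w. normsq N w = 1 \<Longrightarrow> Re (sform N M w w) \<le> b"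
  shows "rayleigh_sup N M \<le> b"
  unfolding rayleigh_sup_def using unit_exists[OF assms(1)] assms(2) by (intro cSUP_least) auto

text \<open>Two forms differ on unit vectors by at most the entrywise sum. This Lipschitz bound is
  the source of the continuity in t of the largest eigenvalue, needed to differentiate its integral
  in the energy estimate.\<close>

lemma rayleigh_sup_dist:
  assumes "0 < N"
  shows "\<bar>rayleigh_sup N M - rayleigh_sup N M'\<bar> \<le> (\<Sum>i<N. \<Sum>k<N. cmod (M i k - M' i k))"
proof -
  have *: "rayleigh_sup N M \<le> rayleigh_sup N M' + (\<Sum>i<N. \<Sum>k<N. cmod (M i k - M' i k))" for M M'
  proof (rule rayleigh_sup_least[OF assms])
    fix w assume w: "normsq N w = 1"
    have "Re (sform N M w w) - Re (sform N M' w w) \<le> (\<Sum>i<N. \<Sum>k<N. cmod (M i k - M' i k))"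
      using cmod_sform_le[of N "\<lambda>i k. M i k - M' i k" w] complex_Re_le_cmod[of "sform N M w w - sform N M' w w"] w
      by (simp add: sform_diff_mat)
    then show "Re (sform N M w w) \<le> rayleigh_sup N M' + (\<Sum>i<N. \<Sum>k<N. cmod (M i k - M' i k))"
      using Re_sform_le_rayleigh_sup[of N M' w] w by simp
  qed
  show ?thesis using *[of M M'] *[of M' M] by (simp add: norm_minus_commute abs_le_iff)
qed

lemma rayleigh_sup_continuous:
  fixes M :: "real \<Rightarrow> nat \<Rightarrow> nat \<Rightarrow> complex"
  assumes "0 < N" and M: "\<And>i k. i < N \<Longrightarrow> k < N \<Longrightarrow> continuous_on A (\<lambda>t. M t i k)"
  shows "continuous_on A (\<lambda>t. rayleigh_sup N (M t))"
  unfolding continuous_on_def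
proof
  fix x assume x: "x \<in> A"
  have "((\<lambda>t. \<Sum>i<N. \<Sum>k<N. cmod (M t i k - M x i k)) \<longlongrightarrow> (\<Sum>i<N. \<Sum>k<N. cmod (M x i k - M x i k))) (at x within A)"
    using M x by (intro tendsto_intros) (auto simp: continuous_on_def)
  then have "((\<lambda>t. \<Sum>i<N. \<Sum>k<N. cmod (M t i k - M x i k)) \<longlongrightarrow> 0) (at x within A)" by simp
  then have "((\<lambda>t. rayleigh_sup N (M t) - rayleigh_sup N (M x)) \<longlongrightarrow> 0) (at x within A)"
    by (rule Lim_null_comparison[rotated]) (auto intro!: always_eventually rayleigh_sup_dist[OF assms(1)])
  then show "((\<lambda>t. rayleigh_sup N (M t)) \<longlongrightarrow> rayleigh_sup N (M x)) (at x within A)"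
    by (simp add: LIM_zero_iff)
qed

text \<open>Evaluating the form at \<open>w - D w / m\<close> turns positivity of \<open>D\<close> into a bound for \<open>D w\<close>.\<close>
lemma normsq_image_le_sform:
  assumes herm: "\<And>i k. i < N \<Longrightarrow> k < N \<Longrightarrow> cnj (D i k) = D k i"
    and pos: "\<And>w. 0 \<le> Re (sform N D w w)"
    and m: "0 < m" "(\<Sum>i<N. \<Sum>k<N. cmod (D i k)) \<le> m"
  shows "normsq N (\<lambda>i. \<Sum>k<N. D i k * w k) \<le> m * Re (sform N D w w)"
proof -
  define u where "u = (\<lambda>i. \<Sum>k<N. D i k * w k)"
  define S where "S = normsq N u"
  have uw: "sform N D u w = of_real S"
  proof -
    have "(\<Sum>k<N. D i k * w k) = u i" for i by (simp add: u_def)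
    then show ?thesis unfolding sform_eq S_def by (simp add: sform_self_eq)
  qed
  have wu: "sform N D w u = of_real S" using cnj_sform[of N D u w] herm uw by simp
  have uu: "Re (sform N D u u) \<le> m * S"
  proof -
    have "Re (sform N D u u) \<le> (\<Sum>i<N. \<Sum>k<N. cmod (D i k)) * S"
      using cmod_sform_le[of N D u] complex_Re_le_cmod[of "sform N D u u"] by (simp add: S_def)
    also have "\<dots> \<le> m * S" using m by (intro mult_right_mono) (auto simp: S_def)
    finally show ?thesis .
  qed
  define t where "t = 1 / m"
  define x where "x = (\<lambda>i. w i - of_real t * u i)"
  have "sform N D x x = sform N D w w - of_real t * of_real S - (of_real t * of_real S - of_real t * (of_real t * sform N D u u))"
    by (simp add: x_def sform_diff_left sform_diff_right sform_scale_left sform_scale_right uw wu algebra_simps)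
  then have "Re (sform N D x x) = Re (sform N D w w) - 2 * t * S + t\<^sup>2 * Re (sform N D u u)"
    by (simp add: power2_eq_square)
  then have "2 * t * S \<le> Re (sform N D w w) + t\<^sup>2 * Re (sform N D u u)" using pos[of x] by linarith
  also have "t\<^sup>2 * Re (sform N D u u) \<le> t\<^sup>2 * (m * S)" using uu by (intro mult_left_mono) auto
  also have "t\<^sup>2 * (m * S) = t * S" using m by (simp add: t_def power2_eq_square)
  finally have "t * S \<le> Re (sform N D w w)" by (simp add: mult_ac)
  then show ?thesis using m by (simp add: t_def S_def u_def field_simps)
qed

lemma mult_mat_vec_fun:
  assumes "A \<in> carrier_mat N N" "i < N"
  shows "(A *\<^sub>v vec N w) $ i = (\<Sum>k<N. A $$ (i,k) * w k)"
  using assms by (auto simp: scalar_prod_def lessThan_atLeast0 intro!: sum.cong)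

text \<open>No compactness of the sphere is used. If the supremum q were not an eigenvalue, D = qI -
  A would be invertible, so Dw could not be small on unit vectors; as D is positive semidefinite,
  \<open>normsq_image_le_sform\<close> then keeps its form above some \<delta> > 0, and q - \<delta>
  would bound the Rayleigh quotients of A.\<close>

lemma rayleigh_sup_eigenvalue:
  assumes N: "0 < N" and A: "A \<in> carrier_mat N N"
    and herm: "\<And>i k. i < N \<Longrightarrow> k < N \<Longrightarrow> cnj (A $$ (i,k)) = A $$ (k,i)"
  shows "eigenvalue A (of_real (rayleigh_sup N (\<lambda>i k. A $$ (i,k))))"
proof (rule ccontr)
  define q where "q = rayleigh_sup N (\<lambda>i k. A $$ (i,k))"
  assume "\<not> ?thesis"
  then have ne: "\<not> eigenvalue A (of_real q)" by (simp add: q_def)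
  define d where "d = (\<lambda>i k. (if i = k then of_real q else 0) - A $$ (i,k))"
  define D where "D = mat N N (\<lambda>(i,k). d i k)"
  have D: "D \<in> carrier_mat N N" by (simp add: D_def)
  have Di: "D $$ (i,k) = d i k" if "i < N" "k < N" for i k using that by (simp add: D_def)
  have dw: "(\<Sum>k<N. d i k * w k) = of_real q * w i - (\<Sum>k<N. A $$ (i,k) * w k)" if "i < N" for i w
    using that by (simp add: d_def ring_distribs sum_subtractf if_distrib[of "\<lambda>x. x * _"] cong: if_cong)
  have sd: "sform N d w w = of_real (q * normsq N w) - sform N (\<lambda>i k. A $$ (i,k)) w w" for w
  proof -
    have "sform N d w w = (\<Sum>i<N. of_real q * (cnj (w i) * w i) - cnj (w i) * (\<Sum>k<N. A $$ (i,k) * w k))"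
      unfolding sform_eq by (intro sum.cong refl, subst dw) (simp_all add: right_diff_distrib mult_ac)
    then show ?thesis by (simp add: sum_subtractf sform_eq sform_self_eq flip: sum_distrib_left)
  qed
  have "det D \<noteq> 0"
  proof
    assume "det D = 0"
    then obtain v where v: "v \<in> carrier_vec N" "v \<noteq> 0\<^sub>v N" "D *\<^sub>v v = 0\<^sub>v N"
      using det_0_iff_vec_prod_zero[OF D] by auto
    have vv: "v = vec N (($) v)" using v(1) by auto
    have "A *\<^sub>v v = of_real q \<cdot>\<^sub>v v"
    proof (rule eq_vecI)
      fix i assume "i < dim_vec (of_real q \<cdot>\<^sub>v v)"
      then have i: "i < N" using v by auto
      have "(D *\<^sub>v v) $ i = (\<Sum>k<N. d i k * v $ k)"
        using i by (subst vv, subst mult_mat_vec_fun[OF D i]) (auto simp: D_def)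
      then have "(\<Sum>k<N. d i k * v $ k) = 0" using v(3) i by simp
      then have "of_real q * v $ i = (\<Sum>k<N. A $$ (i,k) * v $ k)" using dw[OF i, of "($) v"] by simp
      also have "\<dots> = (A *\<^sub>v v) $ i" by (subst (2) vv, subst mult_mat_vec_fun[OF A i]) auto
      finally show "(A *\<^sub>v v) $ i = (of_real q \<cdot>\<^sub>v v) $ i" using i v(1) by simp
    qed (use A v in auto)
    then have "eigenvector A v (of_real q)" using A v by (auto simp: eigenvector_def)
    then show False using ne by (auto simp: eigenvalue_def)
  qed
  then have "D \<in> Units (ring_mat TYPE(complex) N ())" by (rule det_non_zero_imp_unit[OF D])
  then obtain P where P: "P \<in> carrier_mat N N" "P * D = 1\<^sub>m N"
    by (auto simp: Units_def ring_mat_def)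
  define p where "p = 1 + (\<Sum>i<N. \<Sum>k<N. cmod (P $$ (i,k)))"
  define m where "m = 1 + (\<Sum>i<N. \<Sum>k<N. cmod (d i k))"
  have p: "0 < p" unfolding p_def by (intro add_pos_nonneg sum_nonneg) auto
  have m: "0 < m" unfolding m_def by (intro add_pos_nonneg sum_nonneg) auto
  \<comment> \<open>Read off from the chain 1 = |w|^2 <= N p^2 |Dw|^2 <= N p^2 m Re(w, Dw), where
    \<open>p\<close> bounds the inverse and \<open>m\<close> bounds D.\<close>
  define \<delta> where "\<delta> = 1 / (real N * p\<^sup>2 * m)"
  have \<delta>: "0 < \<delta>" using N p m by (simp add: \<delta>_def)
  have dherm: "cnj (d i k) = d k i" if "i < N" "k < N" for i k
    using herm[OF that] by (simp add: d_def)
  have dpos: "0 \<le> Re (sform N d w w)" for w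
    using Re_sform_le_rayleigh_sup[of N "\<lambda>i k. A $$ (i,k)" w] by (simp add: sd q_def)
  have "q \<le> q - \<delta>"
    unfolding q_def
  proof (rule rayleigh_sup_least[OF N], fold q_def)
    fix w assume w: "normsq N w = 1"
    define u where "u = (\<lambda>i. \<Sum>k<N. d i k * w k)"
    have u: "D *\<^sub>v vec N w = vec N u"
      by (rule eq_vecI) (use D in \<open>auto simp: mult_mat_vec_fun[OF D] u_def Di simp del: index_mult_mat_vec\<close>)
    have wi: "w i = (\<Sum>k<N. P $$ (i,k) * u k)" if i: "i < N" for i
    proof -
      have "vec N w = (P * D) *\<^sub>v vec N w" using P by simp
      also have "\<dots> = P *\<^sub>v (D *\<^sub>v vec N w)" by (rule assoc_mult_mat_vec) (use P D in auto)
      also have "\<dots> = P *\<^sub>v vec N u" unfolding u ..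
      finally have "vec N w $ i = (P *\<^sub>v vec N u) $ i" by simp
      then show ?thesis using i by (simp only: mult_mat_vec_fun[OF P(1) i] index_vec)
    qed
    have "cmod (w i) \<le> p * sqrt (normsq N u)" if i: "i < N" for i
    proof -
      have "cmod (w i) \<le> (\<Sum>k<N. cmod (P $$ (i,k)) * sqrt (normsq N u))"
        unfolding wi[OF i] using cmod_sq_le_normsq[of _ N u]
        by (intro order.trans[OF norm_sum] sum_mono) (auto simp: norm_mult intro!: mult_left_mono real_le_rsqrt)
      also have "\<dots> = (\<Sum>k<N. cmod (P $$ (i,k))) * sqrt (normsq N u)" by (simp add: sum_distrib_right)
      also have "\<dots> \<le> p * sqrt (normsq N u)"
      proof (rule mult_right_mono)
        have "(\<Sum>k<N. cmod (P $$ (i,k))) \<le> (\<Sum>i<N. \<Sum>k<N. cmod (P $$ (i,k)))"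
          using i by (intro member_le_sum[of i "{..<N}" "\<lambda>i. \<Sum>k<N. cmod (P $$ (i,k))"]) (auto intro: sum_nonneg)
        then show "(\<Sum>k<N. cmod (P $$ (i,k))) \<le> p" by (simp add: p_def)
      qed simp
      finally show ?thesis .
    qed
    then have "(cmod (w i))\<^sup>2 \<le> p\<^sup>2 * normsq N u" if "i < N" for i
      using power_mono[of "cmod (w i)" "p * sqrt (normsq N u)" 2] that by (simp add: power_mult_distrib)
    then have "normsq N w \<le> (\<Sum>i<N. p\<^sup>2 * normsq N u)" unfolding normsq_def[of N w] by (intro sum_mono) auto
    then have "1 \<le> real N * p\<^sup>2 * normsq N u" using w by simp
    also have "normsq N u \<le> m * Re (sform N d w w)"
      unfolding u_def by (rule normsq_image_le_sform[OF dherm dpos m]) (simp_all add: m_def)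
    then have "real N * p\<^sup>2 * normsq N u \<le> real N * p\<^sup>2 * (m * Re (sform N d w w))"
      by (intro mult_left_mono) auto
    finally have "\<delta> \<le> Re (sform N d w w)" using N p m by (simp add: \<delta>_def field_simps)
    then show "Re (sform N (\<lambda>i k. A $$ (i,k)) w w) \<le> q - \<delta>" using w by (simp add: sd)
  qed
  then show False using \<delta> by simp
qed

lemma hermitian_mat_index:
  assumes "hermitian_mat A" "A \<in> carrier_mat N N" "i < N" "k < N"
  shows "cnj (A $$ (i,k)) = A $$ (k,i)"
proof -
  have "mat_adjoint A $$ (k,i) = cnj (A $$ (i,k))"
    using assms(2-) by (auto simp: mat_adjoint_def mat_of_rows_index)
  then show ?thesis using assms(1) by (simp add: hermitian_mat_def)
qed

text \<open>The set under \<open>Max\<close> is finite because eigenvalues are roots of the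
  characteristic polynomial, and each real eigenvalue is the Rayleigh quotient of its eigenvector.
  The supremum form is the one that is visibly continuous and bounds the quadratic form.\<close>

lemma max_eigenvalue_eq_rayleigh_sup:
  assumes N: "0 < N" and A: "A \<in> carrier_mat N N" and herm: "hermitian_mat A"
  shows "max_eigenvalue A = rayleigh_sup N (\<lambda>i k. A $$ (i,k))"
  unfolding max_eigenvalue_def
proof (rule Max_eqI)
  have "char_poly A \<noteq> 0" using degree_monic_char_poly[OF A] by auto
  then have "finite {x. eigenvalue A x}"
    unfolding eigenvalue_root_char_poly[OF A] by (rule poly_roots_finite)
  then have "finite (complex_of_real -` {x. eigenvalue A x})" by (rule finite_vimageI) (simp add: inj_on_def)
  then show "finite {a::real. eigenvalue A (of_real a)}" by (simp add: vimage_def)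
  show "rayleigh_sup N (\<lambda>i k. A $$ (i,k)) \<in> {a::real. eigenvalue A (of_real a)}"
    using rayleigh_sup_eigenvalue[OF N A hermitian_mat_index[OF herm A]] by simp
  fix a :: real assume "a \<in> {a::real. eigenvalue A (of_real a)}"
  then obtain v where v: "v \<in> carrier_vec N" "v \<noteq> 0\<^sub>v N" "A *\<^sub>v v = of_real a \<cdot>\<^sub>v v"
    using A by (auto simp: eigenvalue_def eigenvector_def)
  have vv: "v = vec N (($) v)" using v(1) by auto
  have "(\<Sum>k<N. A $$ (i,k) * v $ k) = of_real a * v $ i" if "i < N" for i
  proof -
    have "(\<Sum>k<N. A $$ (i,k) * v $ k) = (A *\<^sub>v v) $ i" by (subst (2) vv, subst mult_mat_vec_fun[OF A that]) auto
    then show ?thesis using v that by simp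
  qed
  then have "sform N (\<lambda>i k. A $$ (i,k)) (($) v) (($) v) = (\<Sum>i<N. of_real a * (cnj (v $ i) * v $ i))"
    unfolding sform_eq by (intro sum.cong refl) simp
  then have s: "sform N (\<lambda>i k. A $$ (i,k)) (($) v) (($) v) = of_real (a * normsq N (($) v))"
    using sform_self_eq[of "($) v" N] by (simp flip: sum_distrib_left)
  have "\<exists>i<N. v $ i \<noteq> 0" using v(1,2) by (metis carrier_vecD eq_vecI index_zero_vec(1,2))
  then have "normsq N (($) v) \<noteq> 0" by (auto simp: normsq_0_iff)
  then have "0 < normsq N (($) v)" using normsq_nonneg[of N "($) v"] by linarith
  moreover have "a * normsq N (($) v) \<le> rayleigh_sup N (\<lambda>i k. A $$ (i,k)) * normsq N (($) v)"
    using Re_sform_le_rayleigh_sup[of N "\<lambda>i k. A $$ (i,k)" "($) v"] s by simp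
  ultimately show "a \<le> rayleigh_sup N (\<lambda>i k. A $$ (i,k))" by simp
qed

lemma psd_mat_sform:
  assumes "psd_mat A" "A \<in> carrier_mat N N"
  shows "0 \<le> Re (sform N (\<lambda>i k. A $$ (i,k)) w w)"
proof -
  have "0 \<le> Re ((A *\<^sub>v vec N w) \<bullet>c vec N w)" using assms by (auto simp: psd_mat_def)
  also have "(A *\<^sub>v vec N w) \<bullet>c vec N w = (\<Sum>i<N. (A *\<^sub>v vec N w) $ i * cnj (w i))"
    using assms(2) by (auto simp: scalar_prod_def lessThan_atLeast0 intro!: sum.cong)
  also have "\<dots> = sform N (\<lambda>i k. A $$ (i,k)) w w"
    unfolding sform_eq by (intro sum.cong refl) (simp add: mult_mat_vec_fun[OF assms(2)] mult.commute del: index_mult_mat_vec)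
  finally show ?thesis .
qed

text \<open>The Hermitian part \<open>H\<close> drops out of the derivative of |y|^2, which is -2 Re
  z times the form of L at y. Positivity of L handles Re z >= 0 and the bound by
  \<open>\<alpha>\<close> handles Re z < 0; \<open>c\<close> merges the cases, and the integrating
  factor makes \<open>f\<close> nonincreasing.\<close>

lemma energy_bound:
  fixes y :: "nat \<Rightarrow> real \<Rightarrow> complex" and z :: complex
  assumes T: "0 \<le> T"
    and ode: "\<And>t i. t \<in> {0..T} \<Longrightarrow> i < N \<Longrightarrow>
      (y i has_vector_derivative - (\<Sum>k<N. (\<i> * H t i k + z * L t i k) * y k t)) (at t within {0..T})"
    and H: "\<And>t i k. t \<in> {0..T} \<Longrightarrow> i < N \<Longrightarrow> k < N \<Longrightarrow> cnj (H t i k) = H t k i"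
    and L: "\<And>t i k. t \<in> {0..T} \<Longrightarrow> i < N \<Longrightarrow> k < N \<Longrightarrow> cnj (L t i k) = L t k i"
    and L0: "\<And>t w. t \<in> {0..T} \<Longrightarrow> 0 \<le> Re (sform N (L t) w w)"
    and L1: "\<And>t w. t \<in> {0..T} \<Longrightarrow> Re (sform N (L t) w w) \<le> \<alpha> t * normsq N w"
    and \<alpha>: "continuous_on {0..T} \<alpha>"
  shows "normsq N (\<lambda>i. y i T) \<le> exp (2 * max 0 (- Re z) * integral {0..T} \<alpha>) * normsq N (\<lambda>i. y i 0)"
proof -
  define c where "c = max 0 (- Re z)"
  define E where "E = (\<lambda>t. normsq N (\<lambda>i. y i t))"
  define s where "s = (\<lambda>t. Re (sform N (L t) (\<lambda>i. y i t) (\<lambda>i. y i t)))"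
  define f where "f = (\<lambda>t. E t * exp (- (2 * c * integral {0..t} \<alpha>)))"
  have dE: "(E has_real_derivative - 2 * Re z * s t) (at t within {0..T})" if t: "t \<in> {0..T}" for t
  proof -
    define y' where "y' = (\<lambda>i. - (\<Sum>k<N. (\<i> * H t i k + z * L t i k) * y k t))"
    have E: "E = (\<lambda>t. \<Sum>i<N. (Re (y i t))\<^sup>2 + (Im (y i t))\<^sup>2)"
      by (simp add: E_def normsq_def cmod_power2)
    have "(E has_real_derivative (\<Sum>i<N. 2 * Re (y i t) * Re (y' i) + 2 * Im (y i t) * Im (y' i))) (at t within {0..T})"
      unfolding E
    proof (intro DERIV_sum)
      fix i assume "i \<in> {..<N}"
      then have d: "((\<lambda>t. Re (y i t)) has_real_derivative Re (y' i)) (at t within {0..T})"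
         "((\<lambda>t. Im (y i t)) has_real_derivative Im (y' i)) (at t within {0..T})"
        using ode[OF t, of i] by (auto simp: has_vector_derivative_complex_iff y'_def)
      show "((\<lambda>t. (Re (y i t))\<^sup>2 + (Im (y i t))\<^sup>2) has_real_derivative
         2 * Re (y i t) * Re (y' i) + 2 * Im (y i t) * Im (y' i)) (at t within {0..T})"
        by (rule derivative_eq_intros d refl | simp)+
    qed
    also have "(\<Sum>i<N. 2 * Re (y i t) * Re (y' i) + 2 * Im (y i t) * Im (y' i)) = 2 * Re (\<Sum>i<N. cnj (y i t) * y' i)"
      by (simp add: sum_distrib_left algebra_simps)
    also have "(\<Sum>i<N. cnj (y i t) * y' i) =
       - (\<i> * sform N (H t) (\<lambda>i. y i t) (\<lambda>i. y i t) + z * sform N (L t) (\<lambda>i. y i t) (\<lambda>i. y i t))"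
      by (simp add: y'_def sform_def sum_distrib_left sum_negf sum_subtractf sum.distrib ring_distribs mult_ac)
    also have "2 * Re \<dots> = - 2 * Re z * s t"
      using Im_sform_hermitian[OF H[OF t]] Im_sform_hermitian[OF L[OF t]] by (simp add: s_def)
    finally show ?thesis .
  qed
  have df: "(f has_real_derivative (- 2 * Re z * s t - 2 * c * \<alpha> t * E t) * exp (- (2 * c * integral {0..t} \<alpha>))) (at t within {0..T})"
    if t: "t \<in> {0..T}" for t
  proof -
    note dI = integral_has_real_derivative[OF \<alpha> t]
    show ?thesis unfolding f_def
      by (rule derivative_eq_intros dE[OF t] dI refl | simp add: algebra_simps)+
  qed
  have "f T \<le> f 0"
  proof (rule DERIV_nonpos_imp_decreasing_open[OF T])
    show "continuous_on {0..T} f" using df by (rule DERIV_continuous_on)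
    fix t assume t: "0 < t" "t < T"
    then have t': "t \<in> {0..T}" by simp
    have "- Re z * s t \<le> c * (\<alpha> t * E t)"
    proof -
      have "- Re z * s t \<le> c * s t" using L0[OF t'] by (intro mult_right_mono) (auto simp: c_def s_def)
      also have "\<dots> \<le> c * (\<alpha> t * E t)" using L1[OF t'] by (intro mult_left_mono) (auto simp: c_def s_def E_def)
      finally show ?thesis .
    qed
    then have "(- 2 * Re z * s t - 2 * c * \<alpha> t * E t) * exp (- (2 * c * integral {0..t} \<alpha>)) \<le> 0"
      by (intro mult_nonpos_nonneg) (simp_all add: algebra_simps)
    then show "\<exists>y. (f has_real_derivative y) (at t) \<and> y \<le> 0"
      using df[OF t'] t by (auto simp: at_within_Icc_at)
  qed
  then have "E T * exp (- (2 * c * integral {0..T} \<alpha>)) \<le> E 0" by (simp add: f_def)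
  then show ?thesis by (simp add: E_def c_def exp_minus field_simps)
qed

section \<open>Linear combinations of unitary evolutions\<close>

lemma cmod_inner_le: "cmod (\<Sum>i<N. cnj (u i) * w i) \<le> sqrt (normsq N u) * sqrt (normsq N w)"
proof -
  have "cmod (\<Sum>i<N. cnj (u i) * w i) \<le> (\<Sum>i<N. \<bar>cmod (u i)\<bar> * \<bar>cmod (w i)\<bar>)"
    by (rule order.trans[OF norm_sum]) (simp add: norm_mult)
  also have "\<dots> \<le> L2_set (\<lambda>i. cmod (u i)) {..<N} * L2_set (\<lambda>i. cmod (w i)) {..<N}"
    by (rule L2_set_mult_ineq)
  finally show ?thesis by (simp add: L2_set_def normsq_def)
qed

lemma mat_mult_index:
  assumes "A \<in> carrier_mat N N" "B \<in> carrier_mat N N" "i < N" "j < N"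
  shows "(A * B) $$ (i,j) = (\<Sum>k<N. A $$ (i,k) * B $$ (k,j))"
  using assms by (auto simp: scalar_prod_def lessThan_atLeast0 intro!: sum.cong)

locale dissipative_generator =
  fixes N :: nat and T :: real and H L :: "real \<Rightarrow> complex mat"
  assumes N: "0 < N" and T: "0 < T"
    and H_cont: "cont_mat_fun N T H" and L_cont: "cont_mat_fun N T L"
    and H_herm: "\<And>t. t \<in> {0..T} \<Longrightarrow> hermitian_mat (H t)"
    and L_psd: "\<And>t. t \<in> {0..T} \<Longrightarrow> psd_mat (L t)"
begin

definition \<eta> :: real where
  "\<eta> = integral {0..T} (\<lambda>t. max_eigenvalue (L t))"

text \<open>At z = 1 this is the generator A, at z = ik it is \<i> times the Hermitian H +
  kL.\<close>

definition coeff :: "complex \<Rightarrow> real \<Rightarrow> nat \<Rightarrow> nat \<Rightarrow> complex" where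
  "coeff z t i k = \<i> * H t $$ (i,k) + z * L t $$ (i,k)"

definition fundamental :: "complex \<Rightarrow> real \<Rightarrow> nat \<Rightarrow> nat \<Rightarrow> complex" where
  "fundamental z t i j = lin_flow N (\<lambda>t i k. \<i> * H t $$ (i,k)) (\<lambda>t i k. L t $$ (i,k)) (\<lambda>m. if m = j then 1 else 0) z t i"

lemma carrier: "t \<in> {0..T} \<Longrightarrow> H t \<in> carrier_mat N N" "t \<in> {0..T} \<Longrightarrow> L t \<in> carrier_mat N N"
  using H_cont L_cont by (auto simp: cont_mat_fun_def)

lemma entries_continuous:
  "i < N \<Longrightarrow> k < N \<Longrightarrow> continuous_on {0..T} (\<lambda>t. \<i> * H t $$ (i,k))"
  "i < N \<Longrightarrow> k < N \<Longrightarrow> continuous_on {0..T} (\<lambda>t. L t $$ (i,k))"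
  using H_cont L_cont by (auto simp: cont_mat_fun_def intro!: continuous_intros)

lemma fundamental_0: "fundamental z 0 i j = (if i = j then 1 else 0)"
  by (simp add: fundamental_def lin_flow_initial)

lemma fundamental_derivative:
  "t \<in> {0..T} \<Longrightarrow> i < N \<Longrightarrow> ((\<lambda>s. fundamental z s i j) has_vector_derivative
     - (\<Sum>k<N. coeff z t i k * fundamental z t k j)) (at t within {0..T})"
  unfolding fundamental_def coeff_def by (rule lin_flow_derivative) (auto intro: entries_continuous)

lemma fundamental_holomorphic: "i < N \<Longrightarrow> (\<lambda>z. fundamental z T i j) holomorphic_on UNIV"
  unfolding fundamental_def using T by (intro lin_flow_holomorphic) (auto intro: entries_continuous)

lemma L_herm: "t \<in> {0..T} \<Longrightarrow> hermitian_mat (L t)"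
  using L_psd by (auto simp: psd_mat_def)

lemma max_eigenvalue_L: "t \<in> {0..T} \<Longrightarrow> max_eigenvalue (L t) = rayleigh_sup N (\<lambda>i k. L t $$ (i,k))"
  by (rule max_eigenvalue_eq_rayleigh_sup[OF N]) (auto intro: carrier L_herm)

lemma max_eigenvalue_continuous: "continuous_on {0..T} (\<lambda>t. max_eigenvalue (L t))"
proof (rule continuous_on_eq)
  show "continuous_on {0..T} (\<lambda>t. rayleigh_sup N (\<lambda>i k. L t $$ (i,k)))"
    using N by (rule rayleigh_sup_continuous) (rule entries_continuous)
qed (simp add: max_eigenvalue_L)

lemma \<eta>_nonneg: "0 \<le> \<eta>"
  unfolding \<eta>_def
proof (rule integral_nonneg)
  show "(\<lambda>t. max_eigenvalue (L t)) integrable_on {0..T}"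
    by (rule integrable_continuous_real[OF max_eigenvalue_continuous])
  fix t assume t: "t \<in> {0..T}"
  obtain w where w: "normsq N w = 1" using unit_exists[OF N] by blast
  have "0 \<le> Re (sform N (\<lambda>i k. L t $$ (i,k)) w w)" by (rule psd_mat_sform[OF L_psd[OF t] carrier(2)[OF t]])
  also have "\<dots> \<le> max_eigenvalue (L t)"
    using Re_sform_le_rayleigh_sup[of N "\<lambda>i k. L t $$ (i,k)" w] w by (simp add: max_eigenvalue_L[OF t])
  finally show "0 \<le> max_eigenvalue (L t)" .
qed

text \<open>Stated for an arbitrary solution, since it serves both the growth bound in z and the
  uniqueness of the time-ordered exponential.\<close>

lemma solution_bound:
  assumes "\<And>t i. t \<in> {0..T} \<Longrightarrow> i < N \<Longrightarrow>
      (y i has_vector_derivative - (\<Sum>k<N. coeff z t i k * y k t)) (at t within {0..T})"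
  shows "normsq N (\<lambda>i. y i T) \<le> (exp (\<eta> * max 0 (- Re z)))\<^sup>2 * normsq N (\<lambda>i. y i 0)"
proof -
  have "normsq N (\<lambda>i. y i T) \<le> exp (2 * max 0 (- Re z) * integral {0..T} (\<lambda>t. max_eigenvalue (L t))) * normsq N (\<lambda>i. y i 0)"
  proof (rule energy_bound[where H = "\<lambda>t i k. H t $$ (i,k)" and L = "\<lambda>t i k. L t $$ (i,k)"])
    show "0 \<le> T" using T by simp
    show "(y i has_vector_derivative - (\<Sum>k<N. (\<i> * H t $$ (i,k) + z * L t $$ (i,k)) * y k t)) (at t within {0..T})"
      if "t \<in> {0..T}" "i < N" for t i using assms[OF that] by (simp add: coeff_def)
    show "cnj (H t $$ (i,k)) = H t $$ (k,i)" "cnj (L t $$ (i,k)) = L t $$ (k,i)"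
      if "t \<in> {0..T}" "i < N" "k < N" for t i k
      using that hermitian_mat_index[OF H_herm carrier(1)] hermitian_mat_index[OF L_herm carrier(2)] by auto
    show "0 \<le> Re (sform N (\<lambda>i k. L t $$ (i,k)) w w)" if "t \<in> {0..T}" for t w
      using that by (intro psd_mat_sform L_psd carrier)
    show "Re (sform N (\<lambda>i k. L t $$ (i,k)) w w) \<le> max_eigenvalue (L t) * normsq N w" if "t \<in> {0..T}" for t w
      unfolding max_eigenvalue_L[OF that] by (rule Re_sform_le_rayleigh_sup)
  qed (rule max_eigenvalue_continuous)
  also have "exp (2 * max 0 (- Re z) * integral {0..T} (\<lambda>t. max_eigenvalue (L t))) = (exp (\<eta> * max 0 (- Re z)))\<^sup>2"
    by (simp add: \<eta>_def power2_eq_square flip: exp_add)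
  finally show ?thesis .
qed

text \<open>The Dyson flow gives existence. For uniqueness, a column of the difference of two
  solutions starts at zero, and the energy bound keeps it zero at \<open>T\<close>; this discharges
  the definite description.\<close>

lemma time_ordered_exp_eq:
  assumes B: "\<And>t. t \<in> {0..T} \<Longrightarrow> B t \<in> carrier_mat N N"
    "\<And>t i k. t \<in> {0..T} \<Longrightarrow> i < N \<Longrightarrow> k < N \<Longrightarrow> B t $$ (i,k) = coeff z t i k"
  shows "time_ordered_exp N B T = mat N N (\<lambda>(i,j). fundamental z T i j)"
  unfolding time_ordered_exp_def
proof (rule the_equality)
  define W where "W = (\<lambda>t. mat N N (\<lambda>(i,j). fundamental z t i j))"
  have "texp_solution N B T W"
    unfolding texp_solution_def
  proof (intro conjI ballI allI impI)
    show "W 0 = 1\<^sub>m N" by (rule eq_matI) (auto simp: W_def fundamental_0)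
    fix t i j assume t: "t \<in> {0..T}" and ij: "i < N" "j < N"
    have "(B t * W t) $$ (i,j) = (\<Sum>k<N. coeff z t i k * fundamental z t k j)"
      using ij by (subst mat_mult_index[OF B(1)[OF t] _ ij]) (auto simp: W_def B(2)[OF t])
    then show "((\<lambda>s. W s $$ (i,j)) has_vector_derivative - (B t * W t) $$ (i,j)) (at t within {0..T})"
      using fundamental_derivative[OF t ij(1), of z j] ij by (simp add: W_def)
  qed (simp add: W_def)
  then show "\<exists>V. texp_solution N B T V \<and> V T = mat N N (\<lambda>(i,j). fundamental z T i j)" by (auto simp: W_def)
next
  fix M assume "\<exists>V. texp_solution N B T V \<and> V T = M"
  then obtain V where V: "texp_solution N B T V" and M: "V T = M" by blast
  have Vc: "V t \<in> carrier_mat N N" if "t \<in> {0..T}" for t using V that by (auto simp: texp_solution_def)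
  have "V T $$ (i,j) = fundamental z T i j" if ij: "i < N" "j < N" for i j
  proof -
    define y where "y = (\<lambda>i t. V t $$ (i,j) - fundamental z t i j)"
    have "normsq N (\<lambda>i. y i T) \<le> (exp (\<eta> * max 0 (- Re z)))\<^sup>2 * normsq N (\<lambda>i. y i 0)"
    proof (rule solution_bound)
      fix t i assume t: "t \<in> {0..T}" and i: "i < N"
      have "(B t * V t) $$ (i,j) = (\<Sum>k<N. coeff z t i k * V t $$ (k,j))"
        using i by (subst mat_mult_index[OF B(1)[OF t] Vc[OF t] i ij(2)]) (auto simp: B(2)[OF t])
      then have "((\<lambda>s. V s $$ (i,j)) has_vector_derivative - (\<Sum>k<N. coeff z t i k * V t $$ (k,j))) (at t within {0..T})"
        using V t i ij unfolding texp_solution_def by metis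
      from has_vector_derivative_diff[OF this fundamental_derivative[OF t i, of z j]]
      show "(y i has_vector_derivative - (\<Sum>k<N. coeff z t i k * y k t)) (at t within {0..T})"
        by (simp add: y_def right_diff_distrib sum_subtractf)
    qed
    moreover have "normsq N (\<lambda>i. y i 0) = 0"
      using V ij by (auto simp: normsq_0_iff y_def texp_solution_def fundamental_0)
    ultimately have "normsq N (\<lambda>i. y i T) = 0" using normsq_nonneg[of N "\<lambda>i. y i T"] by simp
    then show ?thesis using ij by (simp add: normsq_0_iff y_def)
  qed
  then show "M = mat N N (\<lambda>(i,j). fundamental z T i j)"
    using Vc[of T] T M by (intro eq_matI) auto
qed

text \<open>The scalar quadrature is applied to z -> (u, W(z) v), where \<open>u\<close> is the
  error vector itself. Its quadrature error is then |u|^2, while Cauchy-Schwarz bounds the function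
  with constant |u| |v|; one factor |u| cancels.\<close>

lemma quadrature_vector_error:
  fixes v :: "nat \<Rightarrow> complex"
  assumes R: "2 \<le> R" and h: "h = 1 / (\<eta> + R + 1)" and n: "n = nat \<lceil>R / h\<rceil>"
  defines "u \<equiv> (\<lambda>i. (\<Sum>k<N. (fundamental 1 T i k -
     (\<Sum>j<2*n+1. quad_weight R h n j * fundamental (\<i> * of_real (quad_node h n j)) T i k)) * v k))"
  shows "sqrt (normsq N u) \<le> 3 * (R + 1/2) * exp (4 - R) * sqrt (normsq N v)"
proof -
  define W where "W = (\<lambda>z i. \<Sum>k<N. fundamental z T i k * v k)"
  define \<phi> where "\<phi> = (\<lambda>z. \<Sum>i<N. cnj (u i) * W z i)"
  define b where "b = sqrt (normsq N u) * sqrt (normsq N v)"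
  have Wb: "sqrt (normsq N (W z)) \<le> exp (\<eta> * max 0 (- Re z)) * sqrt (normsq N v)" for z
  proof -
    define y where "y = (\<lambda>i t. \<Sum>k<N. fundamental z t i k * v k)"
    have "normsq N (\<lambda>i. y i T) \<le> (exp (\<eta> * max 0 (- Re z)))\<^sup>2 * normsq N (\<lambda>i. y i 0)"
    proof (rule solution_bound)
      fix t i assume t: "t \<in> {0..T}" and i: "i < N"
      have "(y i has_vector_derivative (\<Sum>k<N. - (\<Sum>l<N. coeff z t i l * fundamental z t l k) * v k)) (at t within {0..T})"
        unfolding y_def
        by (intro has_vector_derivative_sum has_vector_derivative_mult_left fundamental_derivative t i)
      also have "(\<Sum>k<N. - (\<Sum>l<N. coeff z t i l * fundamental z t l k) * v k) = - (\<Sum>l<N. coeff z t i l * y l t)"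
        unfolding y_def by (simp add: sum_distrib_left sum_distrib_right sum_negf mult_ac) (rule sum.swap)
      finally show "(y i has_vector_derivative - (\<Sum>k<N. coeff z t i k * y k t)) (at t within {0..T})" .
    qed
    moreover have "normsq N (\<lambda>i. y i 0) = normsq N v"
      unfolding normsq_def y_def by (intro sum.cong refl) (simp add: fundamental_0 if_distrib[of "\<lambda>x. x * _"] cong: if_cong)
    ultimately have "normsq N (W z) \<le> (exp (\<eta> * max 0 (- Re z)))\<^sup>2 * normsq N v" by (simp add: y_def W_def)
    then have "sqrt (normsq N (W z)) \<le> sqrt ((exp (\<eta> * max 0 (- Re z)))\<^sup>2 * normsq N v)" by simp
    then show ?thesis by (simp add: real_sqrt_mult)
  qed
  have "cmod (\<phi> 1 - (\<Sum>j<2*n+1. quad_weight R h n j * \<phi> (\<i> * of_real (quad_node h n j)))) \<le> 3 * b * (R + 1/2) * exp (4 - R)"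
  proof (rule quadrature_error[OF _ R \<eta>_nonneg _ h n])
    show "\<phi> holomorphic_on UNIV" unfolding \<phi>_def W_def
      by (intro holomorphic_intros fundamental_holomorphic) auto
    show "0 \<le> b" by (simp add: b_def)
    fix z
    have "cmod (\<phi> z) \<le> sqrt (normsq N u) * sqrt (normsq N (W z))" unfolding \<phi>_def by (rule cmod_inner_le)
    also have "\<dots> \<le> sqrt (normsq N u) * (exp (\<eta> * max 0 (- Re z)) * sqrt (normsq N v))"
      by (intro mult_left_mono Wb) simp
    finally show "cmod (\<phi> z) \<le> b * exp (\<eta> * max 0 (- Re z))" by (simp add: b_def mult_ac)
  qed
  also have "\<phi> 1 - (\<Sum>j<2*n+1. quad_weight R h n j * \<phi> (\<i> * of_real (quad_node h n j))) = of_real (normsq N u)"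
  proof -
    define c where "c = quad_weight R h n"
    define \<kappa> where "\<kappa> = (\<lambda>j. \<i> * complex_of_real (quad_node h n j))"
    have u: "u i = W 1 i - (\<Sum>j<2*n+1. c j * W (\<kappa> j) i)" for i
    proof -
      have "(\<Sum>j<2*n+1. c j * W (\<kappa> j) i) = (\<Sum>k<N. (\<Sum>j<2*n+1. c j * fundamental (\<kappa> j) T i k) * v k)"
        unfolding W_def sum_distrib_left sum_distrib_right by (subst sum.swap) (simp only: mult_ac)
      then show ?thesis
        by (simp only: u_def W_def c_def \<kappa>_def left_diff_distrib sum_subtractf)
    qed
    have "(\<Sum>j<2*n+1. c j * \<phi> (\<kappa> j)) = (\<Sum>i<N. cnj (u i) * (\<Sum>j<2*n+1. c j * W (\<kappa> j) i))"
      unfolding \<phi>_def sum_distrib_left by (subst sum.swap) (simp only: mult_ac)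
    \<comment> \<open>Only the last occurrence of \<open>u\<close>, the unconjugated factor on the
      right, is expanded.\<close>
    then have "\<phi> 1 - (\<Sum>j<2*n+1. c j * \<phi> (\<kappa> j)) = (\<Sum>i<N. cnj (u i) * u i)"
      unfolding \<phi>_def by (subst (4) u) (simp only: right_diff_distrib sum_subtractf)
    then show ?thesis by (simp only: sform_self_eq c_def \<kappa>_def)
  qed
  finally have "normsq N u \<le> 3 * b * (R + 1/2) * exp (4 - R)" by simp
  then have "sqrt (normsq N u) * sqrt (normsq N u) \<le> sqrt (normsq N u) * (3 * (R + 1/2) * exp (4 - R) * sqrt (normsq N v))"
    unfolding b_def real_sqrt_mult_self abs_of_nonneg[OF normsq_nonneg] by (simp only: mult_ac)
  moreover have "0 \<le> 3 * (R + 1/2) * exp (4 - R) * sqrt (normsq N v)" using R by simp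
  \<comment> \<open>Cancels |u|; if it is zero, the bound is trivial.\<close>
  moreover have "a \<le> b" if "a * a \<le> a * b" "0 \<le> b" "0 \<le> a" for a b :: real
    using that by (cases "a = 0") (auto simp: mult_le_cancel_left)
  ultimately show ?thesis using real_sqrt_ge_zero[OF normsq_nonneg] by blast
qed

lemma quadrature_spectral_norm_error:
  assumes R: "2 \<le> R" and h: "h = 1 / (\<eta> + R + 1)" and n: "n = nat \<lceil>R / h\<rceil>"
  shows "spectral_norm (time_ordered_exp N (\<lambda>t. L t + \<i> \<cdot>\<^sub>m H t) T -
     lincomb_mat N (2*n+1) (quad_weight R h n)
       (\<lambda>j. time_ordered_exp N (\<lambda>s. \<i> \<cdot>\<^sub>m (H s + complex_of_real (quad_node h n j) \<cdot>\<^sub>m L s)) T))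
     \<le> 3 * (R + 1/2) * exp (4 - R)" (is "spectral_norm ?M \<le> ?\<delta>")
proof -
  have target: "time_ordered_exp N (\<lambda>t. L t + \<i> \<cdot>\<^sub>m H t) T = mat N N (\<lambda>(i,j). fundamental 1 T i j)"
  proof (rule time_ordered_exp_eq)
    fix t assume "t \<in> {0..T}"
    note c = carrier[OF this]
    show "L t + \<i> \<cdot>\<^sub>m H t \<in> carrier_mat N N" using c by auto
    show "(L t + \<i> \<cdot>\<^sub>m H t) $$ (i,k) = coeff 1 t i k" if "i < N" "k < N" for i k
      using c that by (simp add: coeff_def)
  qed
  have U: "time_ordered_exp N (\<lambda>s. \<i> \<cdot>\<^sub>m (H s + complex_of_real x \<cdot>\<^sub>m L s)) T = mat N N (\<lambda>(i,j). fundamental (\<i> * of_real x) T i j)" for x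
  proof (rule time_ordered_exp_eq)
    fix t assume "t \<in> {0..T}"
    note c = carrier[OF this]
    show "\<i> \<cdot>\<^sub>m (H t + complex_of_real x \<cdot>\<^sub>m L t) \<in> carrier_mat N N" using c by auto
    show "(\<i> \<cdot>\<^sub>m (H t + complex_of_real x \<cdot>\<^sub>m L t)) $$ (i,k) = coeff (\<i> * of_real x) t i k" if "i < N" "k < N" for i k
      using c that by (simp add: coeff_def algebra_simps)
  qed
  have M: "?M \<in> carrier_mat N N"
    unfolding lincomb_mat_def by (intro minus_carrier_mat mat_carrier)
  have Mi: "?M $$ (i,k) = fundamental 1 T i k -
     (\<Sum>j<2*n+1. quad_weight R h n j * fundamental (\<i> * of_real (quad_node h n j)) T i k)" if "i < N" "k < N" for i k
    using that by (simp add: target U lincomb_mat_def)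
  show ?thesis
    unfolding spectral_norm_def
  proof (rule cSup_least)
    \<comment> \<open>\<open>cSup_least\<close> requires a nonempty set; the zero vector provides an
      element.\<close>
    show "{vec_norm2 (?M *\<^sub>v v) |v. v \<in> carrier_vec (dim_col ?M) \<and> vec_norm2 v \<le> 1} \<noteq> {}"
      by (auto simp: vec_norm2_def intro!: exI[of _ "0\<^sub>v (dim_col ?M)"])
    fix x assume "x \<in> {vec_norm2 (?M *\<^sub>v v) |v. v \<in> carrier_vec (dim_col ?M) \<and> vec_norm2 v \<le> 1}"
    then obtain v where x: "x = vec_norm2 (?M *\<^sub>v v)" and v: "v \<in> carrier_vec N" "vec_norm2 v \<le> 1"
      using M by auto
    define u where "u = (\<lambda>i. (\<Sum>k<N. (fundamental 1 T i k -
     (\<Sum>j<2*n+1. quad_weight R h n j * fundamental (\<i> * of_real (quad_node h n j)) T i k)) * v $ k))"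
    have vv: "v = vec N (($) v)" using v by auto
    have "(?M *\<^sub>v v) $ i = u i" if "i < N" for i
      by (subst vv, subst mult_mat_vec_fun[OF M that]) (use that Mi in \<open>auto simp: u_def intro!: sum.cong\<close>)
    then have "x = sqrt (normsq N u)" using M unfolding x vec_norm2_def normsq_def
      by (auto intro!: sum.cong simp del: index_mult_mat_vec)
    also have "\<dots> \<le> ?\<delta> * sqrt (normsq N (($) v))"
      unfolding u_def by (rule quadrature_vector_error[OF R h n])
    also have "\<dots> \<le> ?\<delta> * 1"
      using v R by (intro mult_left_mono) (auto simp: vec_norm2_def normsq_def)
    finally show "x \<le> ?\<delta>" by simp
  qed
qed

end

section \<open>Choice of the parameters and the implied constants\<close>

theorem theorem2:
  "\<exists>C::real. \<exists>\<epsilon>\<^sub>0::real. C > 0 \<and> \<epsilon>\<^sub>0 > 0 \<and>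
    (\<forall>(N::nat) (T::real) (H::real \<Rightarrow> complex mat) (L::real \<Rightarrow> complex mat) (\<epsilon>\<^sub>1::real).
       0 < N \<longrightarrow> 0 < T \<longrightarrow>
       cont_mat_fun N T H \<longrightarrow> cont_mat_fun N T L \<longrightarrow>
       (\<forall>t \<in> {0..T}. hermitian_mat (H t)) \<longrightarrow>
       (\<forall>t \<in> {0..T}. psd_mat (L t)) \<longrightarrow>
       0 < \<epsilon>\<^sub>1 \<longrightarrow> \<epsilon>\<^sub>1 < 1 \<longrightarrow>
       (let A = (\<lambda>t. L t + \<i> \<cdot>\<^sub>m H t);
            \<eta>\<^sub>m\<^sub>a\<^sub>x = integral {0..T} (\<lambda>t. max_eigenvalue (L t))
        in \<exists>(J::nat) (k::nat \<Rightarrow> real) (c::nat \<Rightarrow> complex).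
           (let U = (\<lambda>j. time_ordered_exp N (\<lambda>s. \<i> \<cdot>\<^sub>m (H s + complex_of_real (k j) \<cdot>\<^sub>m L s)) T)
            in spectral_norm (time_ordered_exp N A T - lincomb_mat N J c U) \<le> \<epsilon>\<^sub>1) \<and>
           (\<epsilon>\<^sub>1 < \<epsilon>\<^sub>0 \<longrightarrow>
              real J \<le> C * (ln (1/\<epsilon>\<^sub>1) * (ln (1/\<epsilon>\<^sub>1) + \<eta>\<^sub>m\<^sub>a\<^sub>x)) \<and>
              (\<forall>j<J. \<bar>k j\<bar> \<le> C * ln (1/\<epsilon>\<^sub>1)) \<and>
              (\<Sum>j<J. cmod (c j)) \<le> C)))"
proof -
  \<comment> \<open>1015 = 2 * 506 + 3 comes from counting the nodes and \<open>2 * exp 2\<close>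
    from the sum of the weights.\<close>
  define C :: real where "C = 1015 + 2 * exp 2"
  show ?thesis
  proof (rule exI[of _ C], rule exI[of _ "exp (-1)"], intro conjI allI impI)
    show "0 < C" by (simp add: C_def add_pos_pos)
    show "0 < exp (-1 :: real)" by simp
    fix N :: nat and T :: real and H L :: "real \<Rightarrow> complex mat" and \<epsilon> :: real
    assume asm: "0 < N" "0 < T" "cont_mat_fun N T H" "cont_mat_fun N T L"
      "\<forall>t \<in> {0..T}. hermitian_mat (H t)" "\<forall>t \<in> {0..T}. psd_mat (L t)" and \<epsilon>: "0 < \<epsilon>" "\<epsilon> < 1"
    interpret dissipative_generator N T H L using asm by unfold_locales auto
    \<comment> \<open>Capping at exp(-1) gives l >= 1 for every admissible \<epsilon>. For
      \<epsilon> >= exp(-1) only the accuracy is claimed; below that threshold the cap changes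
      nothing and l = ln(1/\<epsilon>).\<close>
    define \<epsilon>' where "\<epsilon>' = min \<epsilon> (exp (-1))"
    define l where "l = ln (1 / \<epsilon>')"
    \<comment> \<open>Half of R pays for the linear prefactor through R + 1/2 <= 2 exp(R/2). The
      other half is l + 10, leaving exp(-l) times 6 exp(4 - 10), which is at most exp(-l).\<close>
    define R where "R = 2 * l + 20"
    define h where "h = 1 / (\<eta> + R + 1)"
    define n where "n = nat \<lceil>R / h\<rceil>"
    have \<epsilon>': "0 < \<epsilon>'" "\<epsilon>' \<le> \<epsilon>" "\<epsilon>' \<le> exp (-1)" using \<epsilon> by (auto simp: \<epsilon>'_def)
    have "ln \<epsilon>' \<le> ln (exp (-1))" using \<epsilon>' by (subst ln_le_cancel_iff) auto
    then have l: "1 \<le> l" using \<epsilon>' by (simp add: l_def ln_div)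
    have R: "2 \<le> R" using l by (simp add: R_def)
    have h: "0 < h" "h \<le> 1" using R \<eta>_nonneg by (auto simp: h_def)
    have n_le: "real n \<le> R / h + 1"
    proof -
      have "0 \<le> R / h" using R h by simp
      then show ?thesis unfolding n_def by linarith
    qed
    have err: "3 * (R + 1/2) * exp (4 - R) \<le> \<epsilon>"
    proof -
      have "R + 1/2 \<le> 2 * exp (R/2)" using exp_ge_add_one_self[of "R/2"] by linarith
      then have "3 * (R + 1/2) * exp (4 - R) \<le> 3 * (2 * exp (R/2)) * exp (4 - R)" by (intro mult_right_mono) auto
      also have "\<dots> = 6 * exp (- 6) * exp (- l)" by (simp add: R_def flip: exp_add)
      also have "\<dots> \<le> 1 * exp (- l)"
        using exp_ge_add_one_self[of 6] by (intro mult_right_mono) (auto simp: exp_minus field_simps)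
      also have "\<dots> = \<epsilon>'" using \<epsilon>' by (simp add: l_def ln_div)
      finally show ?thesis using \<epsilon>' by linarith
    qed
    have approx: "spectral_norm (time_ordered_exp N (\<lambda>t. L t + \<i> \<cdot>\<^sub>m H t) T -
       lincomb_mat N (2*n+1) (quad_weight R h n)
       (\<lambda>j. time_ordered_exp N (\<lambda>s. \<i> \<cdot>\<^sub>m (H s + complex_of_real (quad_node h n j) \<cdot>\<^sub>m L s)) T)) \<le> \<epsilon>"
      using quadrature_spectral_norm_error[OF R h_def n_def] err by linarith
    have C1: "1015 \<le> C" "2 * exp 2 \<le> C" by (auto simp: C_def)
    have bounds: "real (2*n+1) \<le> C * (ln (1/\<epsilon>) * (ln (1/\<epsilon>) + \<eta>)) \<and>
        (\<forall>j<2*n+1. \<bar>quad_node h n j\<bar> \<le> C * ln (1/\<epsilon>)) \<and> (\<Sum>j<2*n+1. cmod (quad_weight R h n j)) \<le> C"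
      if "\<epsilon> < exp (-1)"
    proof (intro conjI allI impI)
      have l\<epsilon>: "ln (1/\<epsilon>) = l" using that by (simp add: l_def \<epsilon>'_def)
      \<comment> \<open>Since l >= 1, additive constants become multiples: R <= 22 l and 1/h <= 23
        (l + \<eta>), whence 506 = 22 * 23. The 3 left over in 2n + 1 is absorbed by
        \<open>ll\<close>.\<close>
      have R22: "R \<le> 22 * l" using l by (simp add: R_def)
      have ll: "1 \<le> l * (l + \<eta>)" using mult_mono[of 1 l 1 "l + \<eta>"] l \<eta>_nonneg by simp
      have "R / h = R * (\<eta> + R + 1)" by (simp add: h_def)
      also have "\<dots> \<le> (22 * l) * (23 * (l + \<eta>))"
        using R R22 l \<eta>_nonneg by (intro mult_mono) auto
      finally have "R / h \<le> 506 * (l * (l + \<eta>))" by (simp add: algebra_simps)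
      then have "real (2*n+1) \<le> 1015 * (l * (l + \<eta>))" using n_le ll by simp
      also have "\<dots> \<le> C * (l * (l + \<eta>))" using C1 ll by (intro mult_right_mono) auto
      finally show "real (2*n+1) \<le> C * (ln (1/\<epsilon>) * (ln (1/\<epsilon>) + \<eta>))" by (simp only: l\<epsilon>)
      show "\<bar>quad_node h n j\<bar> \<le> C * ln (1/\<epsilon>)" if "j < 2*n+1" for j
      proof -
        have "\<bar>real j - real n\<bar> * h \<le> real n * h" using that h by (intro mult_right_mono) auto
        then have "\<bar>quad_node h n j\<bar> \<le> real n * h" using h by (simp add: quad_node_def abs_mult)
        also have "\<dots> \<le> (R / h + 1) * h" using n_le h by (intro mult_right_mono) auto
        also have "\<dots> = R + h" using h by (simp add: field_simps)
        also have "\<dots> \<le> 1015 * l" using R22 h l by linarith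
        also have "\<dots> \<le> C * l" using C1 l by (intro mult_right_mono) auto
        finally show ?thesis by (simp only: l\<epsilon>)
      qed
      show "(\<Sum>j<2*n+1. cmod (quad_weight R h n j)) \<le> C"
        using quad_weight_sum_le[OF R h, of n] C1 by linarith
    qed
    show "let A = (\<lambda>t. L t + \<i> \<cdot>\<^sub>m H t);
            \<eta>\<^sub>m\<^sub>a\<^sub>x = integral {0..T} (\<lambda>t. max_eigenvalue (L t))
        in \<exists>(J::nat) (k::nat \<Rightarrow> real) (c::nat \<Rightarrow> complex).
           (let U = (\<lambda>j. time_ordered_exp N (\<lambda>s. \<i> \<cdot>\<^sub>m (H s + complex_of_real (k j) \<cdot>\<^sub>m L s)) T)
            in spectral_norm (time_ordered_exp N A T - lincomb_mat N J c U) \<le> \<epsilon>) \<and>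
           (\<epsilon> < exp (-1) \<longrightarrow>
              real J \<le> C * (ln (1/\<epsilon>) * (ln (1/\<epsilon>) + \<eta>\<^sub>m\<^sub>a\<^sub>x)) \<and>
              (\<forall>j<J. \<bar>k j\<bar> \<le> C * ln (1/\<epsilon>)) \<and>
              (\<Sum>j<J. cmod (c j)) \<le> C)"
      unfolding Let_def \<eta>_def[symmetric]
      by (rule exI[of _ "2*n+1"], rule exI[of _ "quad_node h n"], rule exI[of _ "quad_weight R h n"])
        (use approx bounds in blast)
  qed
qed

end
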